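(* Let $m,n$ be two integers. Let $a(z)$ and $b(z)$ be complex Laurent series in $z^{-1}$ with leading terms $z^{2m}$ and $z^{2n}$ respectively. Then, with $ab$ the product series $a(z)b(z)$, $$\Delta(A^{ab}(z))=A^a(z)\otimes A^b(z)+[A^a(z),x^-_0]\otimes[x^+_0,A^b(z)],$$ where $\Delta$ is the coproduct of the Yangian $Y$ of $\mathfrak{sl}_2$, applied coefficientwise to Laurent series in $z^{-1}$.
   Context: All algebras are associative unital over $\mathbb C$, $\otimes=\otimes_{\mathbb C}$, $\mathbb N=\{0,1,2,\dots\}$, $[x,y]=xy-yx$. The Yangian $Y$ of $\mathfrak{sl}_2$ is the algebra with generators $x^+_n,x^-_n,h_n$ ($n\in\mathbb N$) and relations, for $r,s\in\mathbb N$: $[h_r,h_s]=0$; $[h_0,x^\pm_s]=\pm2x^\pm_s$; $[h_{r+1},x^\pm_s]-[h_r,x^\pm_{s+1}]=\pm(h_rx^\pm_s+x^\pm_sh_r)$; $[x^+_r,x^-_s]=h_{r+s}$; $[x^\pm_{r+1},x^\pm_s]-[x^\pm_r,x^\pm_{s+1}]=\pm(x^\pm_rx^\pm_s+x^\pm_sx^\pm_r)$. Put $h(z)=1+\sum_{n\ge0}h_nz^{-n-1}$ and let $Y^=$ be the (commutative) subalgebra generated by all $h_n$. $Y$ is a Hopf algebra whose coproduct is the algebra morphism determined by $\Delta(x^\pm_0)=x^\pm_0\otimes1+1\otimes x^\pm_0$, $\Delta(h_0)=h_0\otimes1+1\otimes h_0$, $\Delta(x^+_1)=x^+_1\otimes1+1\otimes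 x^+_1+h_0\otimes x^+_0$. For an integer $m$ and a complex Laurent series $a(z)$ in $z^{-1}$ with leading term $z^{2m}$, $A^a(z)$ is the unique Laurent series in $z^{-1}$ with leading term $z^m$ and coefficients in $Y^=$ such that $h(z)=\dfrac{a(z)}{A^a(z)A^a(z-1)}$ (expansions in $z^{-1}$). For Laurent series $f(z)=\sum f_iz^{i}$, $g(z)=\sum g_jz^{j}$ in $z^{-1}$ over $Y$, $f(z)\otimes g(z)=\sum_{i,j}f_i\otimes g_j\,z^{i+j}$, a Laurent series in $z^{-1}$ over $Y\otimes Y$. *)

theory Defs
  imports
    "HOL-Library.Poly_Mapping"
    "HOL-Computational_Algebra.Formal_Laurent_Series"
begin

section \<open>Associative unital algebras over the complex numbers\<close>

class complex_algebra_1 = ring_1 +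
  fixes scaleC :: "complex \<Rightarrow> 'a \<Rightarrow> 'a" (infixr "*\<^sub>C" 75)
  assumes scaleC_add_right: "c *\<^sub>C (x + y) = c *\<^sub>C x + c *\<^sub>C y"
    and scaleC_add_left: "(c + d) *\<^sub>C x = c *\<^sub>C x + d *\<^sub>C x"
    and scaleC_scaleC: "c *\<^sub>C d *\<^sub>C x = (c * d) *\<^sub>C x"
    and scaleC_one: "1 *\<^sub>C x = x"
    and mult_scaleC_left: "(c *\<^sub>C x) * y = c *\<^sub>C (x * y)"
    and mult_scaleC_right: "x * (c *\<^sub>C y) = c *\<^sub>C (x * y)"

definition algebra_hom :: "('a::complex_algebra_1 \<Rightarrow> 'b::complex_algebra_1) \<Rightarrow> bool" where
  "algebra_hom f \<longleftrightarrow>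
     (\<forall>x y. f (x + y) = f x + f y) \<and> (\<forall>c x. f (c *\<^sub>C x) = c *\<^sub>C f x) \<and>
     (\<forall>x y. f (x * y) = f x * f y) \<and> f 1 = 1"

inductive_set subalgebra_generated :: "'a::complex_algebra_1 set \<Rightarrow> 'a set" for S where
  generator: "s \<in> S \<Longrightarrow> s \<in> subalgebra_generated S"
| one: "1 \<in> subalgebra_generated S"
| scale: "x \<in> subalgebra_generated S \<Longrightarrow> c *\<^sub>C x \<in> subalgebra_generated S"
| add: "x \<in> subalgebra_generated S \<Longrightarrow> y \<in> subalgebra_generated S
    \<Longrightarrow> x + y \<in> subalgebra_generated S"
| mult: "x \<in> subalgebra_generated S \<Longrightarrow> y \<in> subalgebra_generated S
    \<Longrightarrow> x * y \<in> subalgebra_generated S"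

definition commutator :: "'a::ring \<Rightarrow> 'a \<Rightarrow> 'a" where
  "commutator x y = x * y - y * x"

inductive_set ideal_generated :: "'a::ring_1 set \<Rightarrow> 'a set" for R where
  zero: "0 \<in> ideal_generated R"
| generator: "r \<in> R \<Longrightarrow> a * r * b \<in> ideal_generated R"
| add: "p \<in> ideal_generated R \<Longrightarrow> q \<in> ideal_generated R \<Longrightarrow> p + q \<in> ideal_generated R"

lemma ideal_generated_mult_left:
  "p \<in> ideal_generated R \<Longrightarrow> a * p \<in> ideal_generated R"
  by (induction rule: ideal_generated.induct)
     (auto simp: distrib_left mult.assoc[symmetric] intro: ideal_generated.intros)

lemma ideal_generated_mult_right:
  "p \<in> ideal_generated R \<Longrightarrow> p * a \<in> ideal_generated R"
proof (induction rule: ideal_generated.induct)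
  case (generator r c d)
  then show ?case
    using ideal_generated.generator[of r R c "d * a"] by (simp add: mult.assoc)
qed (auto simp: distrib_right intro: ideal_generated.intros)

lemma ideal_generated_uminus:
  assumes "p \<in> ideal_generated R"
  shows "- p \<in> ideal_generated R"
  using ideal_generated_mult_left[OF assms, of "- 1"] by simp

section \<open>Monoid algebras\<close>

text \<open>
  For a monoid \<open>M\<close> written additively, \<^typ>\<open>'m::monoid_add \<Rightarrow>\<^sub>0 complex\<close> with its convolution
  product is the monoid algebra of \<open>M\<close> over the complex numbers. Scalars act through the
  central elements \<open>single 0 c\<close>.
\<close>

lemma poly_mapping_additive_induct [case_names zero single add]:
  fixes p :: "'m \<Rightarrow>\<^sub>0 'c::comm_monoid_add"
  assumes "P 0" and "\<And>k c. P (Poly_Mapping.single k c)" and "\<And>p q. P p \<Longrightarrow> P q \<Longrightarrow> P (p + q)"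
  shows "P p"
proof (induction p rule: update_induct)
  case const
  show ?case by (rule assms(1))
next
  case (update f k v)
  have "Poly_Mapping.update k v f = f + Poly_Mapping.single k v"
    using update by (intro poly_mapping_eqI)
      (auto simp: lookup_update lookup_add lookup_single in_keys_iff when_def)
  then show ?case using update assms(2,3) by simp
qed

lemma single_0_central:
  fixes p :: "'m::monoid_add \<Rightarrow>\<^sub>0 complex"
  shows "p * Poly_Mapping.single 0 c = Poly_Mapping.single 0 c * p"
  by (induction p rule: poly_mapping_additive_induct)
     (simp_all add: mult_single distrib_left distrib_right mult.commute)

lemma mult_single_0_left_commute:
  fixes p :: "'m::monoid_add \<Rightarrow>\<^sub>0 complex"
  shows "p * (Poly_Mapping.single 0 c * q) = Poly_Mapping.single 0 c * (p * q)"
  by (metis mult.assoc single_0_central)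

lemma single_0_mult_single_0:
  fixes p :: "'m::monoid_add \<Rightarrow>\<^sub>0 complex"
  shows "Poly_Mapping.single 0 c * (Poly_Mapping.single 0 d * p) = Poly_Mapping.single 0 (c * d) * p"
  by (simp add: mult_single flip: mult.assoc)

section \<open>The Yangian\<close>

text \<open>Words over an alphabet form the free monoid; concatenation is written \<open>+\<close>.\<close>

instantiation list :: (type) monoid_add
begin

definition zero_list :: "'a list" where "zero_list = []"
definition plus_list :: "'a list \<Rightarrow> 'a list \<Rightarrow> 'a list" where "plus_list = (@)"

instance by standard (simp_all add: zero_list_def plus_list_def)

end

type_synonym 'g free_algebra = "'g list \<Rightarrow>\<^sub>0 complex"

definition free_gen :: "'g \<Rightarrow> 'g free_algebra" where
  "free_gen g = Poly_Mapping.single [g] 1"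

datatype yangian_gen = XPlus nat | XMinus nat | H nat

inductive_set yangian_relators :: "yangian_gen free_algebra set" where
  hh: "commutator (free_gen (H r)) (free_gen (H s)) \<in> yangian_relators"
| h0_xp: "commutator (free_gen (H 0)) (free_gen (XPlus s)) - 2 * free_gen (XPlus s)
    \<in> yangian_relators"
| h0_xm: "commutator (free_gen (H 0)) (free_gen (XMinus s)) + 2 * free_gen (XMinus s)
    \<in> yangian_relators"
| h_xp: "commutator (free_gen (H (Suc r))) (free_gen (XPlus s))
      - commutator (free_gen (H r)) (free_gen (XPlus (Suc s)))
      - (free_gen (H r) * free_gen (XPlus s) + free_gen (XPlus s) * free_gen (H r))
    \<in> yangian_relators"
| h_xm: "commutator (free_gen (H (Suc r))) (free_gen (XMinus s))
      - commutator (free_gen (H r)) (free_gen (XMinus (Suc s)))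
      + (free_gen (H r) * free_gen (XMinus s) + free_gen (XMinus s) * free_gen (H r))
    \<in> yangian_relators"
| xp_xm: "commutator (free_gen (XPlus r)) (free_gen (XMinus s)) - free_gen (H (r + s))
    \<in> yangian_relators"
| xp_xp: "commutator (free_gen (XPlus (Suc r))) (free_gen (XPlus s))
      - commutator (free_gen (XPlus r)) (free_gen (XPlus (Suc s)))
      - (free_gen (XPlus r) * free_gen (XPlus s) + free_gen (XPlus s) * free_gen (XPlus r))
    \<in> yangian_relators"
| xm_xm: "commutator (free_gen (XMinus (Suc r))) (free_gen (XMinus s))
      - commutator (free_gen (XMinus r)) (free_gen (XMinus (Suc s)))
      + (free_gen (XMinus r) * free_gen (XMinus s) + free_gen (XMinus s) * free_gen (XMinus r))
    \<in> yangian_relators"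

lemma lookup_mult_Nil:
  fixes p q :: "'g free_algebra"
  shows "Poly_Mapping.lookup (p * q) [] = Poly_Mapping.lookup p [] * Poly_Mapping.lookup q []"
proof (induction p rule: poly_mapping_additive_induct)
  case (single k c)
  show ?case
    by (induction q rule: poly_mapping_additive_induct)
       (auto simp: mult_single distrib_left lookup_add lookup_single when_def plus_list_def)
qed (simp_all add: distrib_right lookup_add)

lemma yangian_ideal_lookup_Nil:
  "p \<in> ideal_generated yangian_relators \<Longrightarrow> Poly_Mapping.lookup p [] = 0"
proof (induction rule: ideal_generated.induct)
  case (generator r a b)
  then show ?case
    by (cases rule: yangian_relators.cases)
       (simp_all add: lookup_mult_Nil commutator_def lookup_add lookup_minus free_gen_def lookup_single)
qed (simp_all add: lookup_add)

quotient_type yangian = "yangian_gen free_algebra" /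
  "\<lambda>p q. p - q \<in> ideal_generated yangian_relators"
proof (rule equivpI)
  show "reflp (\<lambda>p q. p - q \<in> ideal_generated yangian_relators)"
    by (simp add: reflp_def ideal_generated.zero)
  show "symp (\<lambda>p q. p - q \<in> ideal_generated yangian_relators)"
    by (rule sympI) (metis ideal_generated_uminus minus_diff_eq)
  show "transp (\<lambda>p q. p - q \<in> ideal_generated yangian_relators)"
  proof (rule transpI)
    fix p q r :: "yangian_gen free_algebra"
    assume "p - q \<in> ideal_generated yangian_relators" "q - r \<in> ideal_generated yangian_relators"
    from ideal_generated.add[OF this] show "p - r \<in> ideal_generated yangian_relators" by simp
  qed
qed

instantiation yangian :: complex_algebra_1
begin

lift_definition zero_yangian :: yangian is 0 .
lift_definition one_yangian :: yangian is 1 .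

lift_definition plus_yangian :: "yangian \<Rightarrow> yangian \<Rightarrow> yangian" is "(+)"
  using ideal_generated.add by (fastforce simp: algebra_simps)

lift_definition uminus_yangian :: "yangian \<Rightarrow> yangian" is uminus
  using ideal_generated_uminus by fastforce

lift_definition minus_yangian :: "yangian \<Rightarrow> yangian \<Rightarrow> yangian" is "(-)"
proof -
  fix p p' q q' :: "yangian_gen free_algebra"
  assume "p - p' \<in> ideal_generated yangian_relators" "q - q' \<in> ideal_generated yangian_relators"
  from ideal_generated.add[OF this(1) ideal_generated_uminus[OF this(2)]]
  show "p - q - (p' - q') \<in> ideal_generated yangian_relators" by (simp add: algebra_simps)
qed

lift_definition times_yangian :: "yangian \<Rightarrow> yangian \<Rightarrow> yangian" is "(*)"
proof -
  fix p p' q q' :: "yangian_gen free_algebra"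
  assume "p - p' \<in> ideal_generated yangian_relators" "q - q' \<in> ideal_generated yangian_relators"
  from ideal_generated.add[OF ideal_generated_mult_right[OF this(1), of q]
      ideal_generated_mult_left[OF this(2), of p']]
  show "p * q - p' * q' \<in> ideal_generated yangian_relators" by (simp add: algebra_simps)
qed

lift_definition scaleC_yangian :: "complex \<Rightarrow> yangian \<Rightarrow> yangian"
  is "\<lambda>c p. Poly_Mapping.single 0 c * p"
  by (metis ideal_generated_mult_left right_diff_distrib)

instance
proof
  show "(0::yangian) \<noteq> 1"
  proof (transfer, rule notI)
    assume "0 - 1 \<in> ideal_generated yangian_relators"
    from yangian_ideal_lookup_Nil[OF this] show False
      by (simp add: lookup_minus lookup_one when_def zero_list_def)
  qed
next
  fix x y u :: "yangian" and c d :: complex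
  show "x + y + u = x + (y + u)" "x + y = y + x" "0 + x = x" "- x + x = 0" "x - y = x + - y"
    by (transfer; simp add: ideal_generated.zero add.assoc add.commute)+
  show "x * y * u = x * (y * u)" "1 * x = x" "x * 1 = x"
    by (transfer; simp add: ideal_generated.zero mult.assoc)+
  show "(x + y) * u = x * u + y * u" "x * (y + u) = x * y + x * u"
    by (transfer; simp add: ideal_generated.zero distrib_left distrib_right)+
  show "c *\<^sub>C (x + y) = c *\<^sub>C x + c *\<^sub>C y"
    by (transfer; simp add: ideal_generated.zero distrib_left)
  show "(c + d) *\<^sub>C x = c *\<^sub>C x + d *\<^sub>C x"
    by (transfer; simp add: ideal_generated.zero single_add distrib_right)
  show "c *\<^sub>C d *\<^sub>C x = (c * d) *\<^sub>C x"
    by (transfer; simp only: single_0_mult_single_0 diff_self ideal_generated.zero)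
  show "1 *\<^sub>C x = x"
    by (transfer; simp add: ideal_generated.zero)
  show "c *\<^sub>C x * y = c *\<^sub>C (x * y)"
    by (transfer; simp add: ideal_generated.zero mult.assoc)
  show "x * (c *\<^sub>C y) = c *\<^sub>C (x * y)"
    by (transfer; simp only: mult_single_0_left_commute diff_self ideal_generated.zero)
qed

end

lift_definition xp :: "nat \<Rightarrow> yangian" is "\<lambda>n. free_gen (XPlus n)" .
lift_definition xm :: "nat \<Rightarrow> yangian" is "\<lambda>n. free_gen (XMinus n)" .
lift_definition h :: "nat \<Rightarrow> yangian" is "\<lambda>n. free_gen (H n)" .

definition yangian_Cartan :: "yangian set" where
  "yangian_Cartan = subalgebra_generated (range h)"

section \<open>Tensor product of algebras\<close>

text \<open>
  \<open>TGen x y\<close> is the formal symbol for a pure tensor; these symbols form the product of the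
  multiplicative monoids of the two algebras. The tensor product is the free vector space on
  them modulo the subspace spanned by the bilinearity relators. This subspace is an ideal of
  the monoid algebra, so the quotient inherits the componentwise product of pure tensors.
\<close>

datatype ('a, 'b) tgen = TGen 'a 'b

instantiation tgen :: (monoid_mult, monoid_mult) monoid_add
begin

definition zero_tgen :: "('a, 'b) tgen" where "zero_tgen = TGen 1 1"

fun plus_tgen :: "('a, 'b) tgen \<Rightarrow> ('a, 'b) tgen \<Rightarrow> ('a, 'b) tgen" where
  "plus_tgen (TGen x y) (TGen x' y') = TGen (x * x') (y * y')"

instance
proof
  fix s t u :: "('a, 'b) tgen"
  show "s + t + u = s + (t + u)" by (cases s; cases t; cases u) (simp add: mult.assoc)
  show "0 + s = s" "s + 0 = s" by (cases s; simp add: zero_tgen_def)+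
qed

end

abbreviation tsym :: "'a \<Rightarrow> 'b \<Rightarrow> ('a, 'b) tgen \<Rightarrow>\<^sub>0 complex" where
  "tsym x y \<equiv> Poly_Mapping.single (TGen x y) 1"

inductive_set tensor_relators ::
    "(('a::complex_algebra_1, 'b::complex_algebra_1) tgen \<Rightarrow>\<^sub>0 complex) set" where
  add_left: "tsym (x + x') y - tsym x y - tsym x' y \<in> tensor_relators"
| add_right: "tsym x (y + y') - tsym x y - tsym x y' \<in> tensor_relators"
| scale_left: "tsym (c *\<^sub>C x) y - Poly_Mapping.single (TGen x y) c \<in> tensor_relators"
| scale_right: "tsym x (c *\<^sub>C y) - Poly_Mapping.single (TGen x y) c \<in> tensor_relators"

inductive_set tensor_null ::
    "(('a::complex_algebra_1, 'b::complex_algebra_1) tgen \<Rightarrow>\<^sub>0 complex) set" where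
  zero: "0 \<in> tensor_null"
| relator: "r \<in> tensor_relators \<Longrightarrow> r \<in> tensor_null"
| scale: "p \<in> tensor_null \<Longrightarrow> Poly_Mapping.single 0 c * p \<in> tensor_null"
| add: "p \<in> tensor_null \<Longrightarrow> q \<in> tensor_null \<Longrightarrow> p + q \<in> tensor_null"

lemma tensor_null_uminus:
  assumes "p \<in> tensor_null"
  shows "- p \<in> tensor_null"
  using tensor_null.scale[OF assms, of "- 1"] by (simp add: single_uminus)

lemma tensor_relators_tsym_left:
  assumes "r \<in> tensor_relators"
  shows "tsym u v * r \<in> tensor_relators"
  using assms
  by cases (simp_all add: right_diff_distrib mult_single distrib_left mult_scaleC_right
      tensor_relators.intros)

lemma tensor_relators_tsym_right:
  assumes "r \<in> tensor_relators"
  shows "r * tsym u v \<in> tensor_relators"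
  using assms
  by cases (simp_all add: left_diff_distrib mult_single distrib_right mult_scaleC_left
      tensor_relators.intros)

lemma single_TGen_eq:
  "Poly_Mapping.single (TGen u v) c = Poly_Mapping.single 0 c * tsym u v"
  for u :: "'a::monoid_mult" and v :: "'b::monoid_mult"
  by (simp add: mult_single)

lemma tensor_null_mult_left:
  assumes "p \<in> tensor_null"
  shows "q * p \<in> tensor_null"
proof (induction q rule: poly_mapping_additive_induct)
  case (single k c)
  have *: "tsym u v * p \<in> tensor_null" for u v
    using assms
  proof induction
    case (scale p c)
    have "tsym u v * (Poly_Mapping.single 0 c * p) = Poly_Mapping.single 0 c * (tsym u v * p)"
      by (rule mult_single_0_left_commute)
    with scale show ?case by (simp add: tensor_null.scale)
  qed (auto simp: distrib_left intro: tensor_null.intros tensor_relators_tsym_left)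
  obtain u v where k: "k = TGen u v" by (cases k)
  have "Poly_Mapping.single k c * p = Poly_Mapping.single 0 c * (tsym u v * p)"
    unfolding k by (subst single_TGen_eq) (rule mult.assoc)
  with * show ?case by (simp only: tensor_null.scale)
qed (auto simp: distrib_right intro: tensor_null.intros)

lemma tensor_null_mult_right:
  assumes "p \<in> tensor_null"
  shows "p * q \<in> tensor_null"
proof (induction q rule: poly_mapping_additive_induct)
  case (single k c)
  have *: "p * tsym u v \<in> tensor_null" for u v
    using assms
    by induction (auto simp: distrib_right mult.assoc intro: tensor_null.intros
        tensor_relators_tsym_right)
  obtain u v where k: "k = TGen u v" by (cases k)
  have "p * Poly_Mapping.single k c = Poly_Mapping.single 0 c * (p * tsym u v)"
    unfolding k by (subst single_TGen_eq) (rule mult_single_0_left_commute)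
  with * show ?case by (simp only: tensor_null.scale)
qed (auto simp: distrib_left intro: tensor_null.intros)

definition linear_extension :: "('k \<Rightarrow> complex) \<Rightarrow> ('k \<Rightarrow>\<^sub>0 complex) \<Rightarrow> complex" where
  "linear_extension w p = (\<Sum>k\<in>Poly_Mapping.keys p. Poly_Mapping.lookup p k * w k)"

lemma linear_extension_superset:
  assumes "finite K" "Poly_Mapping.keys p \<subseteq> K"
  shows "linear_extension w p = (\<Sum>k\<in>K. Poly_Mapping.lookup p k * w k)"
  unfolding linear_extension_def using assms
  by (intro sum.mono_neutral_left) (auto simp: in_keys_iff)

lemma linear_extension_add:
  "linear_extension w (p + q) = linear_extension w p + linear_extension w q"
  using linear_extension_superset[of "Poly_Mapping.keys p \<union> Poly_Mapping.keys q"]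
    Poly_Mapping.keys_add[of p q]
  by (simp add: lookup_add distrib_right sum.distrib)

lemma linear_extension_single:
  "linear_extension w (Poly_Mapping.single k c) = c * w k"
  using linear_extension_superset[of "{k}" "Poly_Mapping.single k c" w] by (simp split: if_splits)

lemma linear_extension_uminus: "linear_extension w (- p) = - linear_extension w p"
  by (simp add: linear_extension_def sum_negf)

lemma linear_extension_diff:
  "linear_extension w (p - q) = linear_extension w p - linear_extension w q"
  using linear_extension_add[of w p "- q"] by (simp add: linear_extension_uminus)

lemma linear_extension_scale:
  fixes p :: "'m::monoid_add \<Rightarrow>\<^sub>0 complex"
  shows "linear_extension w (Poly_Mapping.single 0 c * p) = c * linear_extension w p"
  by (induction p rule: poly_mapping_additive_induct)
     (simp_all add: linear_extension_add linear_extension_single distrib_left mult_single,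
      simp add: linear_extension_def)

lemma ex_normalized_functional:
  "\<exists>f :: 'a::complex_algebra_1 \<Rightarrow> complex.
     (\<forall>x y. f (x + y) = f x + f y) \<and> (\<forall>c x. f (c *\<^sub>C x) = c * f x) \<and> f 1 = 1"
proof -
  interpret vector_space_pair "scaleC :: complex \<Rightarrow> 'a \<Rightarrow> 'a" "(*) :: complex \<Rightarrow> complex \<Rightarrow> complex"
    by standard (simp_all add: scaleC_add_left scaleC_add_right scaleC_scaleC scaleC_one algebra_simps)
  have "vs1.independent {1}" by (simp add: vs1.dependent_single)
  from linear_independent_extend[OF this, of "\<lambda>_. 1"]
  obtain f :: "'a \<Rightarrow> complex" where f: "Vector_Spaces.linear scaleC (*) f" "f 1 = 1" by blast
  show ?thesis
    using f linear_add[OF f(1)] linear_scale[OF f(1)] by blast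
qed

lemma one_not_in_tensor_null: "1 \<notin> tensor_null"
proof
  obtain f :: "'a \<Rightarrow> complex" where f: "\<And>x y. f (x + y) = f x + f y"
    "\<And>c x. f (c *\<^sub>C x) = c * f x" "f 1 = 1" using ex_normalized_functional by blast
  obtain g :: "'b \<Rightarrow> complex" where g: "\<And>x y. g (x + y) = g x + g y"
    "\<And>c x. g (c *\<^sub>C x) = c * g x" "g 1 = 1" using ex_normalized_functional by blast
  define w :: "('a, 'b) tgen \<Rightarrow> complex" where "w = (\<lambda>t. case t of TGen x y \<Rightarrow> f x * g y)"
  have null: "linear_extension w p = 0" if "p \<in> tensor_null" for p
    using that
  proof induction
    case (relator r)
    then show ?case
      by cases (simp_all add: linear_extension_diff linear_extension_single w_def f g
          distrib_left distrib_right mult.assoc mult.left_commute)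
  qed (simp_all add: linear_extension_add linear_extension_scale,
       simp add: linear_extension_def)
  assume "1 \<in> (tensor_null :: (('a, 'b) tgen \<Rightarrow>\<^sub>0 complex) set)"
  from null[OF this] show False
    by (simp add: linear_extension_single zero_tgen_def w_def f g flip: single_one)
qed

quotient_type (overloaded) ('a, 'b) tensor_product =
  "('a::complex_algebra_1, 'b::complex_algebra_1) tgen \<Rightarrow>\<^sub>0 complex" /
  "\<lambda>p q. p - q \<in> tensor_null"
proof (rule equivpI)
  show "reflp (\<lambda>p q :: ('a, 'b) tgen \<Rightarrow>\<^sub>0 complex. p - q \<in> tensor_null)"
    by (simp add: reflp_def tensor_null.zero)
  show "symp (\<lambda>p q :: ('a, 'b) tgen \<Rightarrow>\<^sub>0 complex. p - q \<in> tensor_null)"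
    by (rule sympI) (metis tensor_null_uminus minus_diff_eq)
  show "transp (\<lambda>p q :: ('a, 'b) tgen \<Rightarrow>\<^sub>0 complex. p - q \<in> tensor_null)"
  proof (rule transpI)
    fix p q r :: "('a, 'b) tgen \<Rightarrow>\<^sub>0 complex"
    assume "p - q \<in> tensor_null" "q - r \<in> tensor_null"
    from tensor_null.add[OF this] show "p - r \<in> tensor_null" by simp
  qed
qed

instantiation tensor_product :: (complex_algebra_1, complex_algebra_1) complex_algebra_1
begin

lift_definition zero_tensor_product :: "('a, 'b) tensor_product" is 0 .
lift_definition one_tensor_product :: "('a, 'b) tensor_product" is 1 .

lift_definition plus_tensor_product ::
  "('a, 'b) tensor_product \<Rightarrow> ('a, 'b) tensor_product \<Rightarrow> ('a, 'b) tensor_product" is "(+)"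
  using tensor_null.add by (fastforce simp: algebra_simps)

lift_definition uminus_tensor_product ::
  "('a, 'b) tensor_product \<Rightarrow> ('a, 'b) tensor_product" is uminus
  using tensor_null_uminus by fastforce

lift_definition minus_tensor_product ::
  "('a, 'b) tensor_product \<Rightarrow> ('a, 'b) tensor_product \<Rightarrow> ('a, 'b) tensor_product" is "(-)"
proof -
  fix p p' q q' :: "('a, 'b) tgen \<Rightarrow>\<^sub>0 complex"
  assume "p - p' \<in> tensor_null" "q - q' \<in> tensor_null"
  from tensor_null.add[OF this(1) tensor_null_uminus[OF this(2)]]
  show "p - q - (p' - q') \<in> tensor_null" by (simp add: algebra_simps)
qed

lift_definition times_tensor_product ::
  "('a, 'b) tensor_product \<Rightarrow> ('a, 'b) tensor_product \<Rightarrow> ('a, 'b) tensor_product" is "(*)"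
proof -
  fix p p' q q' :: "('a, 'b) tgen \<Rightarrow>\<^sub>0 complex"
  assume "p - p' \<in> tensor_null" "q - q' \<in> tensor_null"
  from tensor_null.add[OF tensor_null_mult_right[OF this(1), of q]
      tensor_null_mult_left[OF this(2), of p']]
  show "p * q - p' * q' \<in> tensor_null" by (simp add: algebra_simps)
qed

lift_definition scaleC_tensor_product ::
  "complex \<Rightarrow> ('a, 'b) tensor_product \<Rightarrow> ('a, 'b) tensor_product"
  is "\<lambda>c p. Poly_Mapping.single 0 c * p"
  by (metis tensor_null.scale right_diff_distrib)

instance
proof
  show "(0::('a, 'b) tensor_product) \<noteq> 1"
    by transfer (metis diff_0 minus_minus one_not_in_tensor_null tensor_null_uminus)
next
  fix x y u :: "('a, 'b) tensor_product" and c d :: complex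
  show "x + y + u = x + (y + u)" "x + y = y + x" "0 + x = x" "- x + x = 0" "x - y = x + - y"
    by (transfer; simp add: tensor_null.zero add.assoc add.commute)+
  show "x * y * u = x * (y * u)" "1 * x = x" "x * 1 = x"
    by (transfer; simp add: tensor_null.zero mult.assoc)+
  show "(x + y) * u = x * u + y * u" "x * (y + u) = x * y + x * u"
    by (transfer; simp add: tensor_null.zero distrib_left distrib_right)+
  show "c *\<^sub>C (x + y) = c *\<^sub>C x + c *\<^sub>C y"
    by (transfer; simp add: tensor_null.zero distrib_left)
  show "(c + d) *\<^sub>C x = c *\<^sub>C x + d *\<^sub>C x"
    by (transfer; simp add: tensor_null.zero single_add distrib_right)
  show "c *\<^sub>C d *\<^sub>C x = (c * d) *\<^sub>C x"
    by (transfer; simp only: single_0_mult_single_0 diff_self tensor_null.zero)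
  show "1 *\<^sub>C x = x"
    by (transfer; simp add: tensor_null.zero)
  show "c *\<^sub>C x * y = c *\<^sub>C (x * y)"
    by (transfer; simp add: tensor_null.zero mult.assoc)
  show "x * (c *\<^sub>C y) = c *\<^sub>C (x * y)"
    by (transfer; simp only: mult_single_0_left_commute diff_self tensor_null.zero)
qed

end

lift_definition tensor ::
  "'a::complex_algebra_1 \<Rightarrow> 'b::complex_algebra_1 \<Rightarrow> ('a, 'b) tensor_product" (infixr "\<otimes>" 75)
  is "\<lambda>x y. tsym x y" .

lemma tensor_mult: "(x \<otimes> y) * (x' \<otimes> y') = (x * x') \<otimes> (y * y')"
  by transfer (simp add: mult_single tensor_null.zero)

text \<open>
  The elements \<open>xp 0\<close>, \<open>xm 0\<close>, \<open>h 0\<close>, \<open>xp 1\<close> generate the Yangian, so at most one map satisfies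
  this predicate; that one exists is the classical construction of the coproduct.
\<close>

definition is_yangian_coproduct :: "(yangian \<Rightarrow> (yangian, yangian) tensor_product) \<Rightarrow> bool" where
  "is_yangian_coproduct \<Delta> \<longleftrightarrow>
     algebra_hom \<Delta> \<and>
     \<Delta> (xp 0) = xp 0 \<otimes> 1 + 1 \<otimes> xp 0 \<and>
     \<Delta> (xm 0) = xm 0 \<otimes> 1 + 1 \<otimes> xm 0 \<and>
     \<Delta> (h 0) = h 0 \<otimes> 1 + 1 \<otimes> h 0 \<and>
     \<Delta> (xp 1) = xp 1 \<otimes> 1 + 1 \<otimes> xp 1 + h 0 \<otimes> xp 0"

section \<open>Laurent series in the inverse of z\<close>

unbundle fps_syntax

text \<open>
  A Laurent series in \<open>z\<^sup>-\<^sup>1\<close> is represented by a formal Laurent series whose indeterminate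
  stands for \<open>z\<^sup>-\<^sup>1\<close>: the coefficient of \<open>z\<^sup>i\<close> in \<open>f\<close> is \<open>f $$ (-i)\<close>.
\<close>

definition has_leading_term :: "'a::zero_neq_one fls \<Rightarrow> int \<Rightarrow> bool" where
  "has_leading_term f d \<longleftrightarrow> fls_subdegree f = - d \<and> f $$ (- d) = 1"

text \<open>Only meaningful for \<open>\<phi> 0 = 0\<close>.\<close>

definition map_fls :: "('a::zero \<Rightarrow> 'b::zero) \<Rightarrow> 'a fls \<Rightarrow> 'b fls" where
  "map_fls \<phi> f = Abs_fls (\<lambda>k. \<phi> (f $$ k))"

definition complex_fls :: "complex fls \<Rightarrow> 'a::complex_algebra_1 fls" where
  "complex_fls a = map_fls (\<lambda>c. c *\<^sub>C 1) a"

text \<open>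
  The series \<open>f(z - 1)\<close>, from \<open>(z - 1)\<^sup>i = (\<Sum>l. (i gchoose l) (-1)\<^sup>l z\<^sup>i\<^sup>-\<^sup>l)\<close>
  with \<open>i = - j\<close> and \<open>l = k - j\<close>.
\<close>

definition shift_arg :: "'a::complex_algebra_1 fls \<Rightarrow> 'a fls" where
  "shift_arg f = Abs_fls (\<lambda>k. \<Sum>j = fls_subdegree f..k.
     (((- of_int j) gchoose nat (k - j)) * (- 1) ^ nat (k - j)) *\<^sub>C (f $$ j))"

definition tensor_fls ::
  "'a::complex_algebra_1 fls \<Rightarrow> 'b::complex_algebra_1 fls \<Rightarrow> ('a, 'b) tensor_product fls" where
  "tensor_fls f g = Abs_fls (\<lambda>k. \<Sum>i = fls_subdegree f..k - fls_subdegree g.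
     (f $$ i) \<otimes> (g $$ (k - i)))"

definition h_series :: "yangian fls" where
  "h_series = fps_to_fls (Abs_fps (\<lambda>k. case k of 0 \<Rightarrow> 1 | Suc n \<Rightarrow> h n))"

text \<open>
  The denominator \<open>A(z) A(z - 1)\<close> has leading coefficient 1, so
  \<open>fls_right_inverse _ 1\<close> is its inverse.
\<close>

definition A_series :: "int \<Rightarrow> complex fls \<Rightarrow> yangian fls" where
  "A_series m a = (THE A.
     has_leading_term A m \<and> (\<forall>k. A $$ k \<in> yangian_Cartan) \<and>
     h_series = complex_fls a * fls_right_inverse (A * shift_arg A) 1)"

end

theory Submission
  imports Defs
begin

text \<open>
  Put \<open>B = [A, x\<^sup>-\<^sub>0]\<close>, \<open>C = [x\<^sup>+\<^sub>0, A]\<close>, \<open>D = A + [C, x\<^sup>-\<^sub>0]\<close>. The matrix with rows \<open>(A, B)\<close> and \<open>(C, D)\<close>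
  behaves like a monodromy matrix: the claim is the upper left entry of the rule that \<open>\<Delta>\<close> sends
  it to a matrix product. A series with leading term \<open>z\<^sup>m\<close> is determined by two relations that
  mention no generators other than \<open>x\<^sup>\<plusminus>\<^sub>0\<close> and \<open>x\<^sup>+\<^sub>1\<close>, whose coproducts are known:
  \<open>z C(z) = [x\<^sup>+\<^sub>1, A(z)] + A(z) x\<^sup>+\<^sub>0\<close> yields the next coefficient of \<open>C\<close>, hence of \<open>D - A\<close>, and the
  quantum determinant \<open>A(z - 1) D(z) - B(z - 1) C(z) = a(z)\<close> then yields that of \<open>A\<close>. Both sides
  of the claim satisfy these relations for \<open>ab\<close> and the coproducts of the generators: the left
  side because \<open>\<Delta>\<close> is an algebra morphism, the right side by a computation with \<open>2 \<times> 2\<close> matrices.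
\<close>

section \<open>Laurent series over complex algebras\<close>

lemma scaleC_eq_mult: "c *\<^sub>C x = (c *\<^sub>C 1) * x"
  for x :: "'a::complex_algebra_1"
  by (simp add: mult_scaleC_left)

lemma scaleC_zero_right [simp]: "c *\<^sub>C 0 = (0::'a::complex_algebra_1)"
  by (subst scaleC_eq_mult) simp

lemma scaleC_zero_left [simp]: "0 *\<^sub>C x = (0::'a::complex_algebra_1)"
  using scaleC_add_left[of 0 0 x] by simp

lemma scaleC_minus_one: "(-1) *\<^sub>C x = - (x::'a::complex_algebra_1)"
  using scaleC_add_left[of 1 "-1" x] by (simp add: scaleC_one eq_neg_iff_add_eq_0 add.commute)

lemma scaleC_sum_right: "c *\<^sub>C sum f I = (\<Sum>i\<in>I. c *\<^sub>C (f i :: 'a::complex_algebra_1))"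
  by (induction I rule: infinite_finite_induct) (simp_all add: scaleC_add_right)

lemma scaleC_sum_left: "sum f I *\<^sub>C x = (\<Sum>i\<in>I. f i *\<^sub>C (x :: 'a::complex_algebra_1))"
  by (induction I rule: infinite_finite_induct) (simp_all add: scaleC_add_left)

text \<open>The scalars contain 1/2. The comparisons of lowest coefficients below end with twice a
  coefficient being 0.\<close>

lemma add_self_eq_0_iff: "x + x = 0 \<longleftrightarrow> x = (0::'a::complex_algebra_1)"
proof
  assume "x + x = 0"
  moreover have "x = (1/2) *\<^sub>C (x + x)"
    by (simp add: scaleC_add_right scaleC_one flip: scaleC_add_left)
  ultimately show "x = 0" by simp
qed simp

lemma add_self_cancel: "x + x = y + y \<Longrightarrow> x = (y::'a::complex_algebra_1)"
  using add_self_eq_0_iff[of "x - y"] by (simp add: algebra_simps)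

lemma algebra_hom_zero: "algebra_hom \<phi> \<Longrightarrow> \<phi> 0 = 0"
  unfolding algebra_hom_def by (metis add_cancel_right_left)

lemma algebra_hom_sum: "algebra_hom \<phi> \<Longrightarrow> \<phi> (sum f I) = (\<Sum>i\<in>I. \<phi> (f i))"
  by (induction I rule: infinite_finite_induct) (auto simp: algebra_hom_zero, simp add: algebra_hom_def)

lemma algebra_hom_diff: "algebra_hom \<phi> \<Longrightarrow> \<phi> (x - y) = \<phi> x - \<phi> y"
  unfolding algebra_hom_def by (metis add_diff_cancel_right' diff_add_cancel)

text \<open>A bound instead of the exact subdegree: with possible zero divisors the subdegree of a
  product is not determined by its factors, and a bound also passes to sums and differences and
  covers the zero series.\<close>

definition vanishes_below :: "int \<Rightarrow> 'a::zero fls \<Rightarrow> bool" where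
  "vanishes_below d f \<longleftrightarrow> (\<forall>k<d. f $$ k = 0)"

lemma vanishes_below_fls_subdegree: "vanishes_below (fls_subdegree f) f"
  by (simp add: vanishes_below_def)

lemma vanishes_below_mono: "vanishes_below d f \<Longrightarrow> e \<le> d \<Longrightarrow> vanishes_below e f"
  by (simp add: vanishes_below_def)

lemma vanishes_below_add:
  "vanishes_below d f \<Longrightarrow> vanishes_below d g \<Longrightarrow> vanishes_below d (f + (g::'a::monoid_add fls))"
  by (simp add: vanishes_below_def)

lemma vanishes_below_diff:
  "vanishes_below d f \<Longrightarrow> vanishes_below d g \<Longrightarrow> vanishes_below d (f - (g::'a::group_add fls))"
  by (simp add: vanishes_below_def)

lemma fls_eq_shifted_fps:
  assumes "vanishes_below d f"
  shows "f = fls_shift (-d) (fps_to_fls (Abs_fps (\<lambda>n. f $$ (d + int n))))"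
  using assms by (intro fls_eqI) (auto simp: vanishes_below_def)

lemma fls_eqI_from:
  assumes "vanishes_below d f" "vanishes_below d g" "\<And>n. f $$ (d + int n) = g $$ (d + int n)"
  shows "f = g"
  by (subst (1 2) fls_eq_shifted_fps) (use assms in auto)

text \<open>Each factor is a shifted power series, so this is the Cauchy product of power series
  read from the chosen bounds.\<close>

lemma fls_times_from:
  fixes f g :: "'a::ring_1 fls"
  assumes "vanishes_below d f" "vanishes_below e g"
  shows "vanishes_below (d + e) (f * g)"
    and "(f * g) $$ (d + e + int n) = (\<Sum>i\<le>n. f $$ (d + int i) * g $$ (e + int (n - i)))"
proof -
  define F where "F = Abs_fps (\<lambda>n. f $$ (d + int n))"
  define G where "G = Abs_fps (\<lambda>n. g $$ (e + int n))"
  have "f * g = fls_shift (-d) (fps_to_fls F) * fls_shift (-e) (fps_to_fls G)"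
    using fls_eq_shifted_fps[OF assms(1)] fls_eq_shifted_fps[OF assms(2)] by (simp add: F_def G_def)
  also have "\<dots> = fls_shift (- (d + e)) (fps_to_fls (F * G))"
    by (simp add: fls_times_both_shifted_simp fls_times_fps_to_fls)
  finally have *: "f * g = fls_shift (- (d + e)) (fps_to_fls (F * G))" .
  show "vanishes_below (d + e) (f * g)" by (simp add: * vanishes_below_def)
  show "(f * g) $$ (d + e + int n) = (\<Sum>i\<le>n. f $$ (d + int i) * g $$ (e + int (n - i)))"
    by (simp add: * fps_mult_nth F_def G_def atLeast0AtMost)
qed

lemma fls_times_lowest:
  fixes f g :: "'a::ring_1 fls"
  assumes "vanishes_below d f" "vanishes_below e g"
  shows "(f * g) $$ (d + e) = f $$ d * g $$ e"
  using fls_times_from(2)[OF assms, of 0] by simp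

lemma fls_times_commute_coeffs:
  fixes f g :: "'a::ring_1 fls"
  assumes "\<And>i j. f $$ i * g $$ j = g $$ j * f $$ i"
  shows "f * g = g * f"
proof (rule fls_eqI_from[of "fls_subdegree f + fls_subdegree g"])
  note v = vanishes_below_fls_subdegree[of f] vanishes_below_fls_subdegree[of g]
  show "vanishes_below (fls_subdegree f + fls_subdegree g) (f * g)" by (rule fls_times_from v)+
  show "vanishes_below (fls_subdegree f + fls_subdegree g) (g * f)"
    using fls_times_from(1)[OF v(2,1)] by (simp add: add.commute)
  fix n
  show "(f * g) $$ (fls_subdegree f + fls_subdegree g + int n) =
      (g * f) $$ (fls_subdegree f + fls_subdegree g + int n)"
    unfolding fls_times_from(2)[OF v]
      fls_times_from(2)[OF v(2,1), of n, unfolded add.commute[of "fls_subdegree g" "fls_subdegree f"]]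
    by (rule sum.reindex_bij_witness[of _ "\<lambda>i. n - i" "\<lambda>i. n - i"]) (auto simp: assms)
qed

lemma fls_X_inv_commute: "fls_X_inv * f = f * (fls_X_inv :: 'a::ring_1 fls)"
  by (simp add: fls_X_inv_times_conv_shift)

lemma fls_X_inv_left_commute: "f * (fls_X_inv * g) = fls_X_inv * (f * g)"
  for f g :: "'a::ring_1 fls"
  by (metis mult.assoc fls_X_inv_commute)

lemma fls_X_inv_mult_nth: "(fls_X_inv * f) $$ k = f $$ (k + 1)"
  for f :: "'a::ring_1 fls"
  by (simp add: fls_X_inv_times_conv_shift)

section \<open>Coefficientwise images of Laurent series\<close>

lemma map_fls_nth:
  assumes "\<phi> 0 = 0" shows "map_fls \<phi> f $$ k = \<phi> (f $$ k)"
  unfolding map_fls_def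
  by (rule nth_Abs_fls_lower_bound[of "fls_subdegree f"]) (simp add: assms)

lemma vanishes_below_map_fls: "\<phi> 0 = 0 \<Longrightarrow> vanishes_below d f \<Longrightarrow> vanishes_below d (map_fls \<phi> f)"
  by (simp add: vanishes_below_def map_fls_nth)

lemma has_leading_term_altdef:
  "has_leading_term f d \<longleftrightarrow> vanishes_below (-d) f \<and> f $$ (-d) = (1::'a::zero_neq_one)"
proof
  show "has_leading_term f d \<Longrightarrow> vanishes_below (-d) f \<and> f $$ (-d) = 1"
    by (metis has_leading_term_def vanishes_below_fls_subdegree)
  show "vanishes_below (-d) f \<and> f $$ (-d) = 1 \<Longrightarrow> has_leading_term f d"
    by (auto simp: has_leading_term_def vanishes_below_def intro!: fls_subdegree_eqI)
qed

context
  fixes \<phi> :: "'a::complex_algebra_1 \<Rightarrow> 'b::complex_algebra_1"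
  assumes hom: "algebra_hom \<phi>"
begin

lemma map_fls_hom_nth: "map_fls \<phi> f $$ k = \<phi> (f $$ k)"
  by (rule map_fls_nth) (rule algebra_hom_zero[OF hom])

lemma map_fls_add: "map_fls \<phi> (f + g) = map_fls \<phi> f + map_fls \<phi> g"
  using hom by (intro fls_eqI) (simp add: map_fls_hom_nth algebra_hom_def)

lemma map_fls_diff: "map_fls \<phi> (f - g) = map_fls \<phi> f - map_fls \<phi> g"
  by (intro fls_eqI) (simp add: map_fls_hom_nth algebra_hom_diff[OF hom])

lemma map_fls_const: "map_fls \<phi> (fls_const c) = fls_const (\<phi> c)"
  by (intro fls_eqI) (simp add: map_fls_hom_nth algebra_hom_zero[OF hom])

lemma map_fls_X_inv: "map_fls \<phi> fls_X_inv = fls_X_inv"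
  using hom by (intro fls_eqI) (simp add: map_fls_hom_nth algebra_hom_zero[OF hom] algebra_hom_def)

lemma map_fls_mult: "map_fls \<phi> (f * g) = map_fls \<phi> f * map_fls \<phi> g"
proof (rule fls_eqI_from)
  note v = vanishes_below_fls_subdegree[of f] vanishes_below_fls_subdegree[of g]
  note v' = v[THEN vanishes_below_map_fls[where \<phi> = \<phi>, OF algebra_hom_zero[OF hom]]]
  show "vanishes_below (fls_subdegree f + fls_subdegree g) (map_fls \<phi> (f * g))"
    by (intro vanishes_below_map_fls fls_times_from algebra_hom_zero[OF hom] v)
  show "vanishes_below (fls_subdegree f + fls_subdegree g) (map_fls \<phi> f * map_fls \<phi> g)"
    by (intro fls_times_from v')
  fix n
  show "map_fls \<phi> (f * g) $$ (fls_subdegree f + fls_subdegree g + int n) =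
      (map_fls \<phi> f * map_fls \<phi> g) $$ (fls_subdegree f + fls_subdegree g + int n)"
    using hom unfolding map_fls_hom_nth fls_times_from(2)[OF v] fls_times_from(2)[OF v']
    by (simp add: algebra_hom_sum algebra_hom_def)
qed

lemma map_fls_commutator: "map_fls \<phi> (commutator f g) = commutator (map_fls \<phi> f) (map_fls \<phi> g)"
  by (simp add: commutator_def map_fls_diff map_fls_mult)

end

section \<open>Shift of the argument\<close>

text \<open>The coefficient of \<open>z\<^sup>-\<^sup>j\<^sup>-\<^sup>l\<close> in \<open>(z - 1)\<^sup>-\<^sup>j\<close>.\<close>

definition shift_coeff :: "int \<Rightarrow> nat \<Rightarrow> complex" where
  "shift_coeff j l = ((- of_int j) gchoose l) * (- 1) ^ l"

lemma shift_coeff_0 [simp]: "shift_coeff j 0 = 1"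
  by (simp add: shift_coeff_def)

text \<open>This is (z - 1)^(-i) (z - 1)^(-j) = (z - 1)^(-i-j) coefficientwise: the Vandermonde
  identity with the signs collected.\<close>

lemma shift_coeff_convolution:
  "(\<Sum>l\<le>n. shift_coeff i l * shift_coeff j (n - l)) = shift_coeff (i + j) n"
proof -
  have "(\<Sum>l\<le>n. shift_coeff i l * shift_coeff j (n - l)) =
      (\<Sum>l\<le>n. ((- of_int i :: complex) gchoose l) * ((- of_int j) gchoose (n - l))) * (- 1) ^ n"
    unfolding sum_distrib_right
  proof (rule sum.cong)
    fix l assume "l \<in> {..n}"
    then have "(- 1 :: complex) ^ n = (- 1) ^ l * (- 1) ^ (n - l)" by (simp flip: power_add)
    then show "shift_coeff i l * shift_coeff j (n - l) =
      ((- of_int i) gchoose l) * ((- of_int j) gchoose (n - l)) * (- 1) ^ n"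
      by (simp add: shift_coeff_def)
  qed simp
  then show ?thesis
    using gbinomial_Vandermonde[of "- of_int i :: complex" "- of_int j" n]
    by (simp add: shift_coeff_def atLeast0AtMost)
qed

lemma shift_arg_from:
  fixes f :: "'a::complex_algebra_1 fls"
  assumes "vanishes_below d f"
  shows "vanishes_below d (shift_arg f)"
    and "shift_arg f $$ (d + int n) = (\<Sum>i\<le>n. shift_coeff (d + int i) (n - i) *\<^sub>C (f $$ (d + int i)))"
proof -
  have nth: "shift_arg f $$ k = (\<Sum>j=fls_subdegree f..k. shift_coeff j (nat (k - j)) *\<^sub>C (f $$ j))" for k
    unfolding shift_arg_def shift_coeff_def
    by (rule nth_Abs_fls_lower_bound[of "fls_subdegree f"]) simp
  have nth': "shift_arg f $$ k = (\<Sum>j=d..k. shift_coeff j (nat (k - j)) *\<^sub>C (f $$ j))" for k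
  \<comment> \<open>The zero series has \<open>fls_subdegree\<close> 0 by convention, which can lie
    below \<open>d\<close>.\<close>
  proof (cases "f = 0")
    case False
    then have "d \<le> fls_subdegree f"
      using assms by (intro fls_subdegree_geI) (auto simp: vanishes_below_def)
    then show ?thesis unfolding nth by (intro sum.mono_neutral_left) auto
  qed (subst nth, simp)
  show "vanishes_below d (shift_arg f)" by (simp add: vanishes_below_def nth')
  show "shift_arg f $$ (d + int n) = (\<Sum>i\<le>n. shift_coeff (d + int i) (n - i) *\<^sub>C (f $$ (d + int i)))"
    unfolding nth'
    by (rule sum.reindex_bij_witness[of _ "\<lambda>i. d + int i" "\<lambda>j. nat (j - d)"])
       (auto simp: nat_diff_distrib' intro!: arg_cong2[of _ _ _ _ "(*\<^sub>C)"] arg_cong2[of _ _ _ _ shift_coeff])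
qed

lemma shift_arg_lowest: "vanishes_below d f \<Longrightarrow> shift_arg f $$ d = f $$ d"
  using shift_arg_from(2)[of d f 0] by (simp add: scaleC_one)

lemma shift_arg_add: "shift_arg (f + g) = shift_arg f + shift_arg g"
proof -
  define d where "d = min (fls_subdegree f) (fls_subdegree g)"
  have v: "vanishes_below d f" "vanishes_below d g"
    by (rule vanishes_below_mono[OF vanishes_below_fls_subdegree]; simp add: d_def)+
  then have v': "vanishes_below d (f + g)" by (rule vanishes_below_add)
  show ?thesis
    by (rule fls_eqI_from[of d])
       (use shift_arg_from[OF v(1)] shift_arg_from[OF v(2)] shift_arg_from[OF v'] in
         \<open>auto simp: scaleC_add_right sum.distrib intro: vanishes_below_add\<close>)
qed

lemma shift_arg_diff: "shift_arg (f - g) = shift_arg f - shift_arg g"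
  using shift_arg_add[of "f - g" g] by simp

lemma shift_arg_const: "shift_arg (fls_const c) = fls_const c"
proof (rule fls_eqI_from[of 0])
  have v: "vanishes_below 0 (fls_const c)" by (simp add: vanishes_below_def)
  then show "vanishes_below 0 (fls_const c)" .
  from v show "vanishes_below 0 (shift_arg (fls_const c))" by (rule shift_arg_from)
  show "shift_arg (fls_const c) $$ (0 + int n) = fls_const c $$ (0 + int n)" for n
    unfolding shift_arg_from(2)[OF v]
    by (cases n) (auto simp: if_distrib[of "(*\<^sub>C) _"] scaleC_one shift_coeff_def cong: if_cong)
qed

lemma shift_arg_X_inv: "shift_arg fls_X_inv = fls_X_inv - 1"
proof (rule fls_eqI_from[of "-1"])
  have v: "vanishes_below (-1) (fls_X_inv :: 'a fls)" by (simp add: vanishes_below_def)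
  then show "vanishes_below (-1) (shift_arg (fls_X_inv :: 'a fls))" by (rule shift_arg_from)
  show "vanishes_below (-1) (fls_X_inv - 1 :: 'a fls)" by (simp add: vanishes_below_def)
  \<comment> \<open>The exponent of z is 1, so these are the binomial coefficients 1 choose
    \<open>n\<close> with signs, of which only two are nonzero.\<close>
  have "shift_coeff (- 1) n = (if n = 0 then 1 else if n = 1 then - 1 else 0)" for n
    using binomial_gbinomial[of 1 n, where 'a = complex] by (auto simp: shift_coeff_def binomial_eq_0)
  then have "(\<Sum>i\<le>n. shift_coeff (- 1 + int i) (n - i) *\<^sub>C (fls_X_inv $$ (- 1 + int i) :: 'a)) =
      (if n = 0 then 1 else if n = 1 then - 1 else 0)" for n
    by (auto simp: if_distrib[of "(*\<^sub>C) _"] scaleC_one scaleC_minus_one cong: if_cong)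
  then show "shift_arg fls_X_inv $$ (- 1 + int n) = (fls_X_inv - 1 :: 'a fls) $$ (- 1 + int n)" for n
    unfolding shift_arg_from(2)[OF v] by auto
qed

text \<open>Coefficients of \<open>f\<close> and \<open>g\<close> at offsets i and j contribute to
  offset n after n - (i + j) expansion steps; the convolution identity distributes these steps over
  the two factors.\<close>

lemma shift_arg_mult: "shift_arg (f * g) = shift_arg f * shift_arg g"
proof -
  define d e where "d = fls_subdegree f" and "e = fls_subdegree g"
  have v: "vanishes_below d f" "vanishes_below e g"
    by (simp_all add: d_def e_def vanishes_below_fls_subdegree)
  note vS = shift_arg_from(1)[OF v(1)] shift_arg_from(1)[OF v(2)]
  define F G where "F i = f $$ (d + int i)" and "G i = g $$ (e + int i)" for i
  let ?c = "\<lambda>i j l. shift_coeff (d + e + int (i + j)) l"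
  show ?thesis
  proof (rule fls_eqI_from[of "d + e"])
    show "vanishes_below (d + e) (shift_arg (f * g))"
      "vanishes_below (d + e) (shift_arg f * shift_arg g)"
      by (intro shift_arg_from(1) fls_times_from(1) v)+
    fix n
    have c: "?c i j k = (\<Sum>l\<le>k. shift_coeff (d + int i) l * shift_coeff (e + int j) (k - l))"
      for i j k by (simp add: shift_coeff_convolution add_ac)
    have "shift_arg (f * g) $$ (d + e + int n) =
        (\<Sum>p\<le>n. \<Sum>i\<le>p. shift_coeff (d + e + int p) (n - p) *\<^sub>C (F i * G (p - i)))"
      unfolding shift_arg_from(2)[OF fls_times_from(1)[OF v]] fls_times_from(2)[OF v] F_def G_def
      by (simp add: scaleC_sum_right)
    also have "\<dots> = (\<Sum>(i,j) | i + j \<le> n. ?c i j (n - (i + j)) *\<^sub>C (F i * G j))"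
      unfolding sum.triangle_reindex_eq by (intro sum.cong) auto
    also have "\<dots> = (\<Sum>(i,j) | i + j \<le> n. \<Sum>l\<le>n - (i + j).
        (shift_coeff (d + int i) l * shift_coeff (e + int j) (n - (i + j) - l)) *\<^sub>C (F i * G j))"
      by (simp only: c scaleC_sum_left)
    also have "\<dots> = (\<Sum>((i,j),l) \<in> (SIGMA x : {(i,j). i + j \<le> n}. {..n - (fst x + snd x)}).
        (shift_coeff (d + int i) l * shift_coeff (e + int j) (n - (i + j) - l)) *\<^sub>C (F i * G j))"
      by (subst sum.Sigma[symmetric])
         (auto simp: case_prod_unfold intro: finite_subset[of _ "{..n} \<times> {..n}"])
    \<comment> \<open>After \<open>l\<close> expansion steps the coefficient of \<open>f\<close> at
      offset \<open>i\<close> lands at offset \<open>q = i + l\<close> of the shifted left factor,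
      which leaves \<open>n - q\<close> for the right one.\<close>
    also have "\<dots> = (\<Sum>(q,i,j) \<in> (SIGMA q : {..n}. {..q} \<times> {..n - q}).
        (shift_coeff (d + int i) (q - i) * shift_coeff (e + int j) (n - q - j)) *\<^sub>C (F i * G j))"
      by (rule sum.reindex_bij_witness[of _ "\<lambda>(q,i,j). ((i,j),q - i)" "\<lambda>((i,j),l). (i + l, i, j)"])
         (auto simp: algebra_simps diff_diff_add)
    also have "\<dots> = (\<Sum>q\<le>n. \<Sum>i\<le>q. \<Sum>j\<le>n - q.
        (shift_coeff (d + int i) (q - i) * shift_coeff (e + int j) (n - q - j)) *\<^sub>C (F i * G j))"
      by (simp add: sum.Sigma case_prod_unfold sum.cartesian_product)
    also have "\<dots> = (\<Sum>q\<le>n. (\<Sum>i\<le>q. shift_coeff (d + int i) (q - i) *\<^sub>C F i) *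
        (\<Sum>j\<le>n - q. shift_coeff (e + int j) (n - q - j) *\<^sub>C G j))"
      by (simp add: sum_product mult_scaleC_left mult_scaleC_right scaleC_scaleC mult.commute)
    also have "\<dots> = (shift_arg f * shift_arg g) $$ (d + e + int n)"
      unfolding fls_times_from(2)[OF vS] shift_arg_from(2)[OF v(1)] shift_arg_from(2)[OF v(2)]
        F_def G_def ..
    finally show "shift_arg (f * g) $$ (d + e + int n) =
        (shift_arg f * shift_arg g) $$ (d + e + int n)" .
  qed
qed

lemma shift_arg_commutator: "shift_arg (commutator f g) = commutator (shift_arg f) (shift_arg g)"
  by (simp add: commutator_def shift_arg_diff shift_arg_mult)

lemma map_fls_shift_arg:
  assumes "algebra_hom \<phi>"
  shows "map_fls \<phi> (shift_arg f) = shift_arg (map_fls \<phi> f)"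
proof (rule fls_eqI_from)
  note v = vanishes_below_fls_subdegree[of f]
  note v' = vanishes_below_map_fls[where \<phi> = \<phi>, OF algebra_hom_zero[OF assms] v]
  show "vanishes_below (fls_subdegree f) (shift_arg (map_fls \<phi> f))"
    "vanishes_below (fls_subdegree f) (map_fls \<phi> (shift_arg f))"
    by (intro shift_arg_from vanishes_below_map_fls algebra_hom_zero[OF assms] v)+
  show "map_fls \<phi> (shift_arg f) $$ (fls_subdegree f + int n) =
      shift_arg (map_fls \<phi> f) $$ (fls_subdegree f + int n)" for n
    using assms unfolding map_fls_hom_nth[OF assms] shift_arg_from(2)[OF v] shift_arg_from(2)[OF v']
    by (simp add: algebra_hom_sum algebra_hom_def)
qed

section \<open>Tensor products of series\<close>

lemma tensor_add_left: "(x + x') \<otimes> y = x \<otimes> y + x' \<otimes> y"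
proof (transfer)
  fix x x' :: 'a and y :: 'b
  show "tsym (x + x') y - (tsym x y + tsym x' y) \<in> tensor_null"
    using tensor_null.relator[OF tensor_relators.add_left[of x x' y]] by (simp add: algebra_simps)
qed

lemma tensor_zero_left: "0 \<otimes> y = 0"
  using tensor_add_left[of 0 0 y] by simp

lemma tensor_add_right: "x \<otimes> (y + y') = x \<otimes> y + x \<otimes> y'"
proof (transfer)
  fix x :: 'a and y y' :: 'b
  show "tsym x (y + y') - (tsym x y + tsym x y') \<in> tensor_null"
    using tensor_null.relator[OF tensor_relators.add_right[of x y y']] by (simp add: algebra_simps)
qed

lemma tensor_scale_left: "(c *\<^sub>C x) \<otimes> y = c *\<^sub>C (x \<otimes> y)"
proof (transfer)
  fix c and x :: 'a and y :: 'b
  show "tsym (c *\<^sub>C x) y - Poly_Mapping.single 0 c * tsym x y \<in> tensor_null"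
    using tensor_null.relator[OF tensor_relators.scale_left[of c x y]] by (simp add: mult_single)
qed

lemma tensor_scale_right: "x \<otimes> (c *\<^sub>C y) = c *\<^sub>C (x \<otimes> y)"
proof (transfer)
  fix c and x :: 'a and y :: 'b
  show "tsym x (c *\<^sub>C y) - Poly_Mapping.single 0 c * tsym x y \<in> tensor_null"
    using tensor_null.relator[OF tensor_relators.scale_right[of x c y]] by (simp add: mult_single)
qed

lemma tensor_one_one: "1 \<otimes> 1 = 1"
  by transfer (simp add: tensor_null.zero flip: single_one zero_tgen_def)

definition tensor_incl_left :: "'a::complex_algebra_1 \<Rightarrow> ('a, 'b::complex_algebra_1) tensor_product"
  where "tensor_incl_left x = x \<otimes> 1"

definition tensor_incl_right :: "'b::complex_algebra_1 \<Rightarrow> ('a::complex_algebra_1, 'b) tensor_product"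
  where "tensor_incl_right y = 1 \<otimes> y"

lemma algebra_hom_tensor_incl:
  "algebra_hom tensor_incl_left" "algebra_hom tensor_incl_right"
  by (simp_all add: algebra_hom_def tensor_incl_left_def tensor_incl_right_def tensor_mult
      tensor_add_left tensor_add_right tensor_scale_left tensor_scale_right tensor_one_one)

lemmas map_tensor_incl_nth [simp] =
  algebra_hom_tensor_incl[THEN map_fls_hom_nth]

lemma tensor_incl_mult: "tensor_incl_left x * tensor_incl_right y = x \<otimes> y"
  "tensor_incl_right y * tensor_incl_left x = x \<otimes> y"
  by (simp_all add: tensor_incl_left_def tensor_incl_right_def tensor_mult)

lemma vanishes_below_map_tensor_incl:
  "vanishes_below d f \<Longrightarrow> vanishes_below d (map_fls tensor_incl_left f)"
  "vanishes_below e g \<Longrightarrow> vanishes_below e (map_fls tensor_incl_right g)"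
  by (auto simp: vanishes_below_def algebra_hom_tensor_incl[THEN algebra_hom_zero])

text \<open>Through the two embeddings of the factors, a tensor product of series becomes an
  ordinary product, so the laws for products and for morphisms apply to it.\<close>

lemma tensor_fls_eq_mult:
  "tensor_fls f g = map_fls tensor_incl_left f * map_fls tensor_incl_right g"
proof (rule fls_eqI)
  fix k
  define d e where "d = fls_subdegree f" and "e = fls_subdegree g"
  have v: "vanishes_below d (map_fls tensor_incl_left f)"
    "vanishes_below e (map_fls tensor_incl_right g)"
    by (simp_all add: d_def e_def vanishes_below_map_tensor_incl vanishes_below_fls_subdegree)
  have nth: "tensor_fls f g $$ k = (\<Sum>i=d..k - e. (f $$ i) \<otimes> (g $$ (k - i)))"
    unfolding tensor_fls_def d_def e_def
    by (rule nth_Abs_fls_lower_bound[of "fls_subdegree f + fls_subdegree g"]) simp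
  show "tensor_fls f g $$ k = (map_fls tensor_incl_left f * map_fls tensor_incl_right g) $$ k"
  proof (cases "k < d + e")
    case True
    with fls_times_from(1)[OF v] nth show ?thesis by (simp add: vanishes_below_def)
  next
    case False
    then obtain n where k: "k = d + e + int n" by (metis zle_iff_zadd linorder_not_less)
    show ?thesis
      unfolding nth unfolding k fls_times_from(2)[OF v] map_tensor_incl_nth tensor_incl_mult
      by (rule sum.reindex_bij_witness[of _ "\<lambda>i. d + int i" "\<lambda>i. nat (i - d)"])
         (auto simp: of_nat_diff algebra_simps)
  qed
qed

lemma mult_interchange: "b * c = c * b \<Longrightarrow> (a * b) * (c * d) = (a * c) * (b * d)"
  for a b c d :: "'a::semigroup_mult"
  by (metis mult.assoc)

lemma tensor_fls_mult:
  "tensor_fls f g * tensor_fls f' g' = tensor_fls (f * f') (g * g')"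
proof -
  \<comment> \<open>The two embedded algebras commute elementwise, hence so do series over
    them.\<close>
  have "map_fls tensor_incl_right g * map_fls tensor_incl_left f' =
      map_fls tensor_incl_left f' * map_fls tensor_incl_right g"
    by (rule fls_times_commute_coeffs) (simp add: tensor_incl_mult)
  then show ?thesis
    unfolding tensor_fls_eq_mult map_fls_mult[OF algebra_hom_tensor_incl(1)]
      map_fls_mult[OF algebra_hom_tensor_incl(2)]
    by (rule mult_interchange)
qed

lemma tensor_fls_add_left: "tensor_fls (f + f') g = tensor_fls f g + tensor_fls f' g"
  and tensor_fls_add_right: "tensor_fls f (g + g') = tensor_fls f g + tensor_fls f g'"
  and tensor_fls_diff_left: "tensor_fls (f - f') g = tensor_fls f g - tensor_fls f' g"
  and tensor_fls_diff_right: "tensor_fls f (g - g') = tensor_fls f g - tensor_fls f g'"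
  by (simp_all add: tensor_fls_eq_mult algebra_simps
      algebra_hom_tensor_incl[THEN map_fls_add] algebra_hom_tensor_incl[THEN map_fls_diff])

lemma tensor_fls_zero [simp]: "tensor_fls 0 g = 0" "tensor_fls f 0 = 0"
  using tensor_fls_diff_left[of 0 0 g] tensor_fls_diff_right[of f 0 0] by simp_all

lemma tensor_fls_minus_left: "tensor_fls (- f) g = - tensor_fls f g"
  and tensor_fls_minus_right: "tensor_fls f (- g) = - tensor_fls f g"
  using tensor_fls_diff_left[of 0 f g] tensor_fls_diff_right[of f 0 g] by simp_all

lemma tensor_fls_const: "tensor_fls (fls_const x) (fls_const y) = fls_const (x \<otimes> y)"
  by (simp add: tensor_fls_eq_mult algebra_hom_tensor_incl[THEN map_fls_const] tensor_incl_mult)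

lemma shift_arg_tensor_fls: "shift_arg (tensor_fls f g) = tensor_fls (shift_arg f) (shift_arg g)"
  by (simp add: tensor_fls_eq_mult shift_arg_mult algebra_hom_tensor_incl[THEN map_fls_shift_arg])

lemma fls_X_inv_tensor_fls:
  "fls_X_inv * tensor_fls f g = tensor_fls (fls_X_inv * f) g"
  "fls_X_inv * tensor_fls f g = tensor_fls f (fls_X_inv * g)"
  unfolding tensor_fls_eq_mult map_fls_mult[OF algebra_hom_tensor_incl(1)]
      map_fls_mult[OF algebra_hom_tensor_incl(2)] map_fls_X_inv[OF algebra_hom_tensor_incl(1)]
      map_fls_X_inv[OF algebra_hom_tensor_incl(2)]
  by (simp_all only: mult.assoc fls_X_inv_left_commute)

lemma tensor_fls_lowest:
  assumes "vanishes_below d f" "vanishes_below e g"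
  shows "vanishes_below (d + e) (tensor_fls f g)" "tensor_fls f g $$ (d + e) = (f $$ d) \<otimes> (g $$ e)"
  using fls_times_from(1)[OF vanishes_below_map_tensor_incl(1)[OF assms(1)]
      vanishes_below_map_tensor_incl(2)[OF assms(2)]]
    fls_times_lowest[OF vanishes_below_map_tensor_incl(1)[OF assms(1)]
      vanishes_below_map_tensor_incl(2)[OF assms(2)]]
  by (simp_all add: tensor_fls_eq_mult tensor_incl_mult)

section \<open>Series with scalar coefficients\<close>

lemma complex_fls_nth: "complex_fls a $$ k = (a $$ k) *\<^sub>C 1"
  by (simp add: complex_fls_def map_fls_nth)

lemma vanishes_below_complex_fls: "vanishes_below d a \<Longrightarrow> vanishes_below d (complex_fls a)"
  by (simp add: vanishes_below_def complex_fls_nth)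

lemma complex_fls_mult: "complex_fls (a * b) = complex_fls a * complex_fls b"
proof (rule fls_eqI_from)
  note v = vanishes_below_fls_subdegree[of a] vanishes_below_fls_subdegree[of b]
  show "vanishes_below (fls_subdegree a + fls_subdegree b) (complex_fls (a * b))"
    "vanishes_below (fls_subdegree a + fls_subdegree b) (complex_fls a * complex_fls b)"
    by (intro vanishes_below_complex_fls fls_times_from v)+
  show "complex_fls (a * b) $$ (fls_subdegree a + fls_subdegree b + int n) =
      (complex_fls a * complex_fls b) $$ (fls_subdegree a + fls_subdegree b + int n)" for n
    unfolding complex_fls_nth fls_times_from(2)[OF v]
      fls_times_from(2)[OF v[THEN vanishes_below_complex_fls]]
    by (simp add: scaleC_sum_left mult_scaleC_left scaleC_scaleC)
qed

lemma complex_fls_one: "complex_fls 1 = 1"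
  by (rule fls_eqI) (simp add: complex_fls_nth scaleC_one)

lemma complex_fls_central: "complex_fls a * f = f * complex_fls a"
  by (rule fls_times_commute_coeffs) (simp add: complex_fls_nth mult_scaleC_left mult_scaleC_right)

lemma map_fls_complex_fls: "algebra_hom \<phi> \<Longrightarrow> map_fls \<phi> (complex_fls a) = complex_fls a"
  by (rule fls_eqI) (simp add: complex_fls_nth map_fls_hom_nth, simp add: algebra_hom_def)

lemma tensor_fls_complex_fls: "tensor_fls (complex_fls a) (complex_fls b) = complex_fls (a * b)"
  by (simp add: tensor_fls_eq_mult complex_fls_mult algebra_hom_tensor_incl[THEN map_fls_complex_fls])

section \<open>Commutators\<close>

lemma commutator_self [simp]: "commutator x x = 0"
  and commutator_zero [simp]: "commutator 0 x = 0" "commutator x 0 = 0"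
  and commutator_add_left: "commutator (x + y) w = commutator x w + commutator y w"
  and commutator_add_right: "commutator x (y + w) = commutator x y + commutator x w"
  and commutator_diff_left: "commutator (x - y) w = commutator x w - commutator y w"
  and commutator_diff_right: "commutator x (y - w) = commutator x y - commutator x w"
  and commutator_minus_left: "commutator (- x) y = - commutator x y"
  and commutator_minus_right: "commutator x (- y) = - commutator x y"
  by (simp_all add: commutator_def algebra_simps)

lemma commutator_swap: "commutator y x = - commutator x y"
  by (simp add: commutator_def)

lemma commutator_mult_right: "commutator x (y * w) = commutator x y * w + y * commutator x w"
  and commutator_mult_left: "commutator (x * y) w = x * commutator y w + commutator x w * y"
  by (simp_all add: commutator_def algebra_simps)

lemma commutator_jacobi:
  "commutator x (commutator y w) = commutator (commutator x y) w + commutator y (commutator x w)"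
  by (simp add: commutator_def algebra_simps)

lemma commutator_X_inv_mult:
  "commutator f (fls_X_inv * g) = fls_X_inv * commutator f g"
  "commutator (fls_X_inv * g) f = fls_X_inv * commutator g f"
  for f g :: "'a::ring_1 fls"
  by (simp_all add: commutator_def right_diff_distrib mult.assoc fls_X_inv_left_commute)

lemma fls_const_commutator: "fls_const (commutator x y) = commutator (fls_const x) (fls_const y)"
  for x y :: "'a::ring_1"
  by (simp add: commutator_def flip: fls_minus_const)

lemma commutator_fls_const_nth:
  "commutator (fls_const x) f $$ k = commutator x (f $$ k)"
  "commutator f (fls_const x) $$ k = commutator (f $$ k) x"
  for f :: "'a::ring_1 fls"
  by (simp_all add: commutator_def)

lemma vanishes_below_commutator_const:
  "vanishes_below d f \<Longrightarrow> vanishes_below d (commutator (fls_const x) f)"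
  "vanishes_below d f \<Longrightarrow> vanishes_below d (commutator f (fls_const x))"
  for f :: "'a::ring_1 fls"
  by (simp_all add: vanishes_below_def commutator_fls_const_nth)

section \<open>Two relations that determine a quantum minor\<close>

text \<open>The last equation prescribes the quantum determinant.\<close>

definition minor_relations ::
    "'a::complex_algebra_1 \<Rightarrow> 'a \<Rightarrow> 'a \<Rightarrow> 'a fls \<Rightarrow> int \<Rightarrow> 'a fls \<Rightarrow> bool" where
  "minor_relations e f e1 c m A \<longleftrightarrow> has_leading_term A m \<and>
     fls_X_inv * commutator (fls_const e) A =
       commutator (fls_const e1) A + A * fls_const e \<and>
     shift_arg A * (A + commutator (commutator (fls_const e) A) (fls_const f))
       - shift_arg (commutator A (fls_const f)) * commutator (fls_const e) A = c"

text \<open>Let \<delta> = A - A' start at index k. The first relation puts C - C' at index k + 1 or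
  later, so D - D' has the same coefficient at k as \<delta>. The difference of the two determinants
  then begins with twice that coefficient, which must vanish.\<close>

lemma minor_relations_unique:
  assumes "minor_relations e f e1 c m A" "minor_relations e f e1 c m A'"
  shows "A = A'"
proof (rule ccontr)
  assume "A \<noteq> A'"
  define \<delta> k where "\<delta> = A - A'" and "k = fls_subdegree \<delta>"
  define B B' where "B = commutator A (fls_const f)" and "B' = commutator A' (fls_const f)"
  define C C' where "C = commutator (fls_const e) A" and "C' = commutator (fls_const e) A'"
  define D D' where "D = A + commutator C (fls_const f)" and "D' = A' + commutator C' (fls_const f)"
  have A: "vanishes_below (-m) A" "A $$ (-m) = 1" and A': "vanishes_below (-m) A'" "A' $$ (-m) = 1"
    using assms by (simp_all add: minor_relations_def has_leading_term_altdef)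
  have \<delta>k: "\<delta> $$ k \<noteq> 0"
    unfolding k_def by (rule nth_fls_subdegree_nonzero) (use \<open>A \<noteq> A'\<close> in \<open>simp add: \<delta>_def\<close>)
  have v\<delta>: "vanishes_below k \<delta>" by (simp add: k_def vanishes_below_fls_subdegree)
  have vB: "vanishes_below (-m) B" unfolding B_def by (intro vanishes_below_commutator_const A)
  have vBB: "vanishes_below k (B - B')"
    using vanishes_below_commutator_const(2)[OF v\<delta>]
    by (simp add: B_def B'_def \<delta>_def commutator_diff_left)
  \<comment> \<open>The leading coefficient 1 commutes with \<open>e\<close>, so bracketing removes
    it.\<close>
  have vC': "vanishes_below (-m + 1) C'"
    unfolding vanishes_below_def
  proof (intro allI impI)
    fix j assume "j < -m + 1"
    then consider "j < -m" | "j = -m" by linarith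
    then show "C' $$ j = 0"
      by cases (use A' in \<open>auto simp: C'_def commutator_fls_const_nth commutator_def vanishes_below_def\<close>)
  qed
  have CC: "fls_X_inv * (C - C') = commutator (fls_const e1) \<delta> + \<delta> * fls_const e"
    using assms by (simp add: minor_relations_def C_def C'_def \<delta>_def commutator_diff_right algebra_simps)
  have vCC: "vanishes_below (k + 1) (C - C')"
    unfolding vanishes_below_def
  proof (intro allI impI)
    fix j assume "j < k + 1"
    then have "\<delta> $$ (j - 1) = 0" using v\<delta> by (simp add: vanishes_below_def)
    moreover have "(C - C') $$ j = (fls_X_inv * (C - C')) $$ (j - 1)"
      by (simp add: fls_X_inv_mult_nth)
    ultimately show "(C - C') $$ j = 0" unfolding CC by (simp add: commutator_fls_const_nth)
  qed
  have DD: "D - D' = \<delta> + commutator (C - C') (fls_const f)"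
    by (simp add: D_def D'_def \<delta>_def commutator_diff_left)
  have vDD: "vanishes_below k (D - D')" "(D - D') $$ k = \<delta> $$ k"
    using vanishes_below_commutator_const(2)[OF vCC, of f] v\<delta>
    by (auto simp: DD vanishes_below_def)
  have vD': "vanishes_below (-m) D'" "D' $$ (-m) = 1"
    using vanishes_below_commutator_const(2)[OF vC', of f] A'
    by (auto simp: D'_def vanishes_below_def)
  have "shift_arg A * D - shift_arg B * C = shift_arg A' * D' - shift_arg B' * C'"
    using assms by (simp add: minor_relations_def B_def B'_def C_def C'_def D_def D'_def)
  \<comment> \<open>Both products on the right start beyond \<open>-m + k\<close>, because C - C'
    and C' each start one index late.\<close>
  then have "shift_arg A * (D - D') + shift_arg \<delta> * D' =
      shift_arg B * (C - C') + shift_arg (B - B') * C'"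
    by (simp add: \<delta>_def shift_arg_diff algebra_simps)
  moreover have "(shift_arg A * (D - D') + shift_arg \<delta> * D') $$ (-m + k) = \<delta> $$ k + \<delta> $$ k"
    using fls_times_lowest[OF shift_arg_from(1)[OF A(1)] vDD(1)]
      fls_times_lowest[OF shift_arg_from(1)[OF v\<delta>] vD'(1)]
      shift_arg_lowest[OF A(1)] shift_arg_lowest[OF v\<delta>] A(2) vDD(2) vD'(2)
    by (simp add: algebra_simps)
  moreover have "(shift_arg B * (C - C') + shift_arg (B - B') * C') $$ (-m + k) = 0"
    using fls_times_from(1)[OF shift_arg_from(1)[OF vB] vCC]
      fls_times_from(1)[OF shift_arg_from(1)[OF vBB] vC']
    by (simp add: vanishes_below_def algebra_simps)
  ultimately show False using \<delta>k add_self_eq_0_iff by metis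
qed

text \<open>The relations involve only the three elements, z and a scalar series, which every
  morphism fixes. They can therefore be carried through the coproduct without knowing its values on
  all h_n.\<close>

lemma minor_relations_map_fls:
  assumes "algebra_hom \<phi>" "minor_relations e f e1 (complex_fls c) m A"
  shows "minor_relations (\<phi> e) (\<phi> f) (\<phi> e1) (complex_fls c) m (map_fls \<phi> A)"
proof -
  note hom = map_fls_commutator[OF assms(1)] map_fls_mult[OF assms(1)] map_fls_add[OF assms(1)]
    map_fls_diff[OF assms(1)] map_fls_const[OF assms(1)] map_fls_X_inv[OF assms(1)]
    map_fls_shift_arg[OF assms(1)] map_fls_complex_fls[OF assms(1)]
  have "has_leading_term (map_fls \<phi> A) m"
    using assms vanishes_below_map_fls[where \<phi> = \<phi>, OF algebra_hom_zero[OF assms(1)]]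
    by (simp add: has_leading_term_altdef minor_relations_def map_fls_hom_nth)
       (simp add: algebra_hom_def)
  moreover have "map_fls \<phi> (fls_X_inv * commutator (fls_const e) A) =
      map_fls \<phi> (commutator (fls_const e1) A + A * fls_const e)"
    "map_fls \<phi> (shift_arg A * (A + commutator (commutator (fls_const e) A) (fls_const f))
       - shift_arg (commutator A (fls_const f)) * commutator (fls_const e) A) =
      map_fls \<phi> (complex_fls c)"
    using assms(2) by (simp_all add: minor_relations_def)
  ultimately show ?thesis
    unfolding minor_relations_def hom by blast
qed

section \<open>Coproduct of a monodromy matrix\<close>

text \<open>An abstract copy of x^+_0, x^-_0, x^+_1 with \<open>commutator e f\<close> in the role
  of h_0. The last assumption is the quadratic relation for r = s = 0 after division by 2.\<close>

locale current_generators =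
  fixes e f e1 :: "'a::complex_algebra_1"
  assumes weight_e: "commutator (commutator e f) e = e + e"
    and weight_f: "commutator (commutator e f) f = - (f + f)"
    and commutator_e1_e: "commutator e1 e = e * e"
begin

abbreviation (input) "E \<equiv> fls_const e"
abbreviation (input) "F \<equiv> fls_const f"
abbreviation (input) "E1 \<equiv> fls_const e1"
abbreviation (input) "H0 \<equiv> commutator E F"
abbreviation (input) "H1 \<equiv> commutator E1 F"

lemma H0_E: "commutator H0 E = E + E"
  using weight_e by (simp flip: fls_const_commutator add: fls_plus_const)

lemma H0_F: "commutator H0 F = - (F + F)"
  using weight_f by (simp flip: fls_const_commutator fls_const_uminus add: fls_plus_const)

lemma E1_E: "commutator E1 E = E * E"
  using commutator_e1_e by (simp flip: fls_const_commutator)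

end

text \<open>Beyond the definitions of B, C and D, these are the properties checked directly in the
  Yangian by \<open>monodromy_Cartan_factor\<close>. The other relations among the four entries
  follow by bracketing with \<open>e\<close> and \<open>f\<close>.\<close>

locale monodromy = current_generators +
  fixes c :: "complex fls" and m :: int and A B C D :: "'a fls"
  assumes leading: "has_leading_term A m"
    and B_def: "B = commutator A F"
    and C_def: "C = commutator E A"
    and D_def: "D = A + commutator C F"
    and X_inv_C: "fls_X_inv * C = commutator E1 A + A * E"
    and H0_A: "commutator H0 A = 0"
    and H1_A: "commutator H1 A = 0"
    and E_C: "commutator E C = 0"
    and B_F: "commutator B F = 0"
    and A_B: "shift_arg A * B = shift_arg B * A"
    and A_D: "shift_arg A * D - shift_arg B * C = complex_fls c"
begin

section \<open>Adjoint action of e and f on the matrix entries\<close>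

lemma C_F: "commutator C F = D - A"
  by (simp add: D_def)

text \<open>The lemmas up to \<open>D_F\<close> amount to this: A + D commutes with \<open>e\<close>
  and \<open>f\<close>, while C, A - D and B transform as in the adjoint representation of
  sl_2.\<close>

lemma H0_B: "commutator H0 B = - (B + B)"
  by (simp add: B_def commutator_jacobi[of H0] H0_A H0_F commutator_minus_right
      commutator_diff_right)

lemma H0_C: "commutator H0 C = C + C"
  by (simp add: C_def commutator_jacobi[of H0] H0_A H0_E commutator_add_left)

lemma E_B: "commutator E B = D - A"
  by (simp add: B_def commutator_jacobi[of E A] C_F commutator_swap[of A H0] H0_A flip: C_def)

lemma E_D: "commutator E D = - C"
  by (simp add: D_def commutator_add_right commutator_jacobi[of E C F] E_C
      commutator_swap[of C H0] H0_C flip: C_def)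

lemma D_F: "commutator D F = - B"
proof -
  have "commutator (commutator E B) F = commutator E (commutator B F) - commutator B H0"
    using commutator_jacobi[of E B F] by simp
  then have "commutator (D - A) F = - (B + B)"
    by (simp add: E_B B_F H0_B commutator_swap[of B H0])
  then show ?thesis
    by (simp add: commutator_diff_left B_def[symmetric] algebra_simps)
qed

lemma shift_arg_C: "shift_arg C = commutator E (shift_arg A)"
  by (simp add: C_def shift_arg_commutator shift_arg_const)

lemma E_shift_arg_B: "commutator E (shift_arg B) = shift_arg D - shift_arg A"
  using E_B by (metis shift_arg_commutator shift_arg_const shift_arg_diff)

text \<open>Bracketing the exchange relation \<open>A_B\<close> with \<open>E\<close> identifies two
  forms of the quantum determinant.\<close>

lemma D_A: "shift_arg D * A - shift_arg C * B = complex_fls c"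
proof -
  have "commutator E (shift_arg A * B) = commutator E (shift_arg B * A)" by (simp add: A_B)
  then have "shift_arg C * B + shift_arg A * (D - A) =
      (shift_arg D - shift_arg A) * A + shift_arg B * C"
    by (simp add: commutator_mult_right E_B E_shift_arg_B flip: C_def shift_arg_C)
  then show ?thesis by (simp add: algebra_simps flip: A_D)
qed

text \<open>The determinant is a scalar series, hence central; its vanishing bracket with
  \<open>E\<close> is exactly this exchange relation.\<close>

lemma C_D: "shift_arg C * D = shift_arg D * C"
proof -
  have "commutator E (shift_arg A * D - shift_arg B * C) = 0"
    by (simp add: A_D) (simp add: commutator_def complex_fls_central)
  then show ?thesis
    by (simp add: commutator_diff_right commutator_mult_right E_D E_C E_shift_arg_B
        algebra_simps flip: shift_arg_C)
qed

text \<open>This is the bracket of \<open>X_inv_C\<close> with \<open>F\<close>; the Jacobi term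
  containing \<open>H1\<close> drops out because A commutes with \<open>H1\<close>.\<close>

lemma X_inv_D: "fls_X_inv * D = fls_X_inv * A + commutator E1 B + H0 * A + B * E"
proof -
  have "fls_X_inv * (D - A) = commutator (commutator E1 A + A * E) F"
    by (simp add: commutator_X_inv_mult flip: C_F X_inv_C)
  also have "\<dots> = commutator E1 B + A * H0 + B * E"
    using commutator_jacobi[of E1 A F]
    by (simp add: commutator_add_left commutator_mult_left H1_A commutator_swap[of A H1]
        flip: B_def)
  also have "A * H0 = H0 * A" using H0_A by (simp add: commutator_def[of H0 A])
  finally show ?thesis by (simp add: algebra_simps)
qed

text \<open>Bracketing \<open>X_inv_C\<close> with \<open>E\<close> kills the left side. On the
  right, \<open>commutator E E1\<close> is -E^2, whose bracket with A is -2 C E.\<close>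

lemma E1_C: "commutator E1 C = C * E"
proof -
  have "commutator E (fls_X_inv * C) = 0" by (simp add: commutator_X_inv_mult E_C)
  then have "commutator (commutator E E1) A + commutator E1 C + C * E = 0"
    by (simp add: X_inv_C commutator_add_right commutator_jacobi[of E E1] commutator_mult_right
        flip: C_def)
  moreover have "commutator E E1 = - (E * E)" using E1_E by (simp add: commutator_swap[of E E1])
  moreover have "E * C = C * E" using E_C by (simp add: commutator_def[of E C])
  ultimately show ?thesis
    by (simp add: commutator_minus_left commutator_mult_left algebra_simps del: fls_const_mult_const
        flip: C_def)
qed

end

lemma commutator_primitive_tensor_fls:
  "commutator (fls_const (x \<otimes> 1 + 1 \<otimes> x)) (tensor_fls u v) =
     tensor_fls (commutator (fls_const x) u) v + tensor_fls u (commutator (fls_const x) v)"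
  "commutator (tensor_fls u v) (fls_const (x \<otimes> 1 + 1 \<otimes> x)) =
     tensor_fls (commutator u (fls_const x)) v + tensor_fls u (commutator v (fls_const x))"
  by (simp_all add: commutator_def tensor_fls_mult tensor_fls_add_left tensor_fls_add_right
      tensor_fls_diff_left tensor_fls_diff_right algebra_simps
      flip: fls_plus_const tensor_fls_const)

context current_generators
begin

text \<open>The third element carries the non-primitive term of the coproduct of x^+_1; it is what
  makes the product of two matrices satisfy the first relation again.\<close>

lemma minor_relations_tensor:
  assumes 1: "monodromy e f e1 a m A\<^sub>1 B\<^sub>1 C\<^sub>1 D\<^sub>1" and 2: "monodromy e f e1 b n A\<^sub>2 B\<^sub>2 C\<^sub>2 D\<^sub>2"
  shows "minor_relations (e \<otimes> 1 + 1 \<otimes> e) (f \<otimes> 1 + 1 \<otimes> f)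
      (e1 \<otimes> 1 + 1 \<otimes> e1 + commutator e f \<otimes> e) (complex_fls (a * b)) (m + n)
      (tensor_fls A\<^sub>1 A\<^sub>2 + tensor_fls B\<^sub>1 C\<^sub>2)"
proof -
  interpret L: monodromy e f e1 a m A\<^sub>1 B\<^sub>1 C\<^sub>1 D\<^sub>1 by fact
  interpret R: monodromy e f e1 b n A\<^sub>2 B\<^sub>2 C\<^sub>2 D\<^sub>2 by fact
  note distrib = tensor_fls_add_left tensor_fls_add_right tensor_fls_diff_left tensor_fls_diff_right
    tensor_fls_minus_left tensor_fls_minus_right
  \<comment> \<open>The entries of the matrix product. The next three facts show that
    \<open>B'\<close>, \<open>C'\<close> and \<open>D'\<close> arise from \<open>A'\<close> by the
    brackets that occur in \<open>minor_relations\<close>.\<close>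
  define A' B' C' D' where "A' = tensor_fls A\<^sub>1 A\<^sub>2 + tensor_fls B\<^sub>1 C\<^sub>2"
    and "B' = tensor_fls A\<^sub>1 B\<^sub>2 + tensor_fls B\<^sub>1 D\<^sub>2"
    and "C' = tensor_fls C\<^sub>1 A\<^sub>2 + tensor_fls D\<^sub>1 C\<^sub>2"
    and "D' = tensor_fls C\<^sub>1 B\<^sub>2 + tensor_fls D\<^sub>1 D\<^sub>2"
  have C': "commutator (fls_const (e \<otimes> 1 + 1 \<otimes> e)) A' = C'"
    by (simp add: A'_def C'_def commutator_add_right commutator_primitive_tensor_fls distrib
        L.E_B R.E_C flip: L.C_def R.C_def)
  have B': "commutator A' (fls_const (f \<otimes> 1 + 1 \<otimes> f)) = B'"
    by (simp add: A'_def B'_def commutator_add_left commutator_primitive_tensor_fls distrib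
        L.B_F R.C_F flip: L.B_def R.B_def)
  have D': "A' + commutator C' (fls_const (f \<otimes> 1 + 1 \<otimes> f)) = D'"
    by (simp add: A'_def C'_def D'_def commutator_add_left commutator_primitive_tensor_fls distrib
        L.C_F L.D_F R.C_F flip: R.B_def)
  have "has_leading_term A' (m + n)"
  proof -
    have A: "vanishes_below (-m) A\<^sub>1" "A\<^sub>1 $$ (-m) = 1" "vanishes_below (-n) A\<^sub>2" "A\<^sub>2 $$ (-n) = 1"
      using L.leading R.leading by (simp_all add: has_leading_term_altdef)
    \<comment> \<open>The leading coefficient 1 of the left A commutes with \<open>f\<close>, so the
      left B has no term in z^m and the second summand of \<open>A'\<close> does not reach
      z^(m+n).\<close>
    have BC: "vanishes_below (-m) B\<^sub>1" "vanishes_below (-n) C\<^sub>2" "B\<^sub>1 $$ (-m) = 0"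
      using A by (simp_all add: L.B_def R.C_def vanishes_below_commutator_const
          commutator_fls_const_nth) (simp add: commutator_def)
    show ?thesis
      using tensor_fls_lowest[OF A(1,3)] tensor_fls_lowest[OF BC(1,2)] A BC(3)
      by (simp add: A'_def has_leading_term_altdef vanishes_below_def tensor_one_one
          tensor_zero_left)
  qed
  moreover have "fls_X_inv * C' =
      commutator (fls_const (e1 \<otimes> 1 + 1 \<otimes> e1 + commutator e f \<otimes> e)) A' +
      A' * fls_const (e \<otimes> 1 + 1 \<otimes> e)"
  proof -
    have EC: "E * C\<^sub>2 = C\<^sub>2 * E" using R.E_C by (simp add: commutator_def[of E C\<^sub>2])
    have EA: "E * A\<^sub>2 = A\<^sub>2 * E + C\<^sub>2" by (simp add: R.C_def commutator_def)
    have AH: "A\<^sub>1 * H0 = H0 * A\<^sub>1" using L.H0_A by (simp add: commutator_def[of H0 A\<^sub>1])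
    have BH: "B\<^sub>1 * H0 = H0 * B\<^sub>1 + (B\<^sub>1 + B\<^sub>1)"
      using L.H0_B by (simp add: commutator_def[of H0 B\<^sub>1] algebra_simps)
    have "fls_X_inv * C' = tensor_fls (fls_X_inv * C\<^sub>1) A\<^sub>2 + tensor_fls (fls_X_inv * D\<^sub>1) C\<^sub>2"
      by (simp add: C'_def distrib_left fls_X_inv_tensor_fls(1))
    \<comment> \<open>By \<open>L.X_inv_D\<close>, z times the left D contains z times the left A.
      That z moves to the right tensor factor, where the relation for the right C applies.\<close>
    also have "\<dots> = tensor_fls (fls_X_inv * C\<^sub>1) A\<^sub>2 + tensor_fls A\<^sub>1 (fls_X_inv * C\<^sub>2) +
        tensor_fls (commutator E1 B\<^sub>1 + H0 * A\<^sub>1 + B\<^sub>1 * E) C\<^sub>2"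
      by (simp add: L.X_inv_D distrib fls_X_inv_tensor_fls(2) flip: fls_X_inv_tensor_fls(1))
    also have "\<dots> = tensor_fls (commutator E1 A\<^sub>1 + A\<^sub>1 * E) A\<^sub>2 +
        tensor_fls A\<^sub>1 (commutator E1 A\<^sub>2 + A\<^sub>2 * E) +
        tensor_fls (commutator E1 B\<^sub>1 + H0 * A\<^sub>1 + B\<^sub>1 * E) C\<^sub>2"
      by (simp only: L.X_inv_C R.X_inv_C)
    \<comment> \<open>The bracket of \<open>tensor_fls H0 E\<close> with \<open>A'\<close> is
      \<open>tensor_fls (H0 * A\<^sub>1) C\<^sub>2\<close> minus twice
      \<open>tensor_fls B\<^sub>1 (C\<^sub>2 * E)\<close>. The latter cancels one such term from
      \<open>R.E1_C\<close> and one from \<open>A'\<close> times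
      \<open>tensor_fls 1 E\<close>.\<close>
    also have "\<dots> = commutator (fls_const (e1 \<otimes> 1 + 1 \<otimes> e1)) A' +
        commutator (tensor_fls H0 E) A' + A' * (tensor_fls E 1 + tensor_fls 1 E)"
      by (simp add: A'_def commutator_add_right commutator_primitive_tensor_fls R.E1_C)
         (simp add: commutator_def[of "tensor_fls H0 E"] tensor_fls_mult distrib distrib_left
            distrib_right EC EA AH BH)
    also have "tensor_fls H0 E = fls_const (commutator e f \<otimes> e)"
      by (simp add: fls_const_commutator flip: tensor_fls_const)
    also have "commutator (fls_const (e1 \<otimes> 1 + 1 \<otimes> e1)) A' +
        commutator (fls_const (commutator e f \<otimes> e)) A' =
        commutator (fls_const (e1 \<otimes> 1 + 1 \<otimes> e1 + commutator e f \<otimes> e)) A'"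
      by (simp add: commutator_add_left flip: fls_plus_const)
    also have "tensor_fls E 1 + tensor_fls 1 E = fls_const (e \<otimes> 1 + 1 \<otimes> e)"
      by (simp flip: fls_plus_const tensor_fls_const)
    finally show ?thesis .
  qed
  moreover have "shift_arg A' * D' - shift_arg B' * C' = complex_fls (a * b)"
  proof -
    let ?A\<^sub>1 = "shift_arg A\<^sub>1" and ?B\<^sub>1 = "shift_arg B\<^sub>1" and ?A\<^sub>2 = "shift_arg A\<^sub>2" and ?B\<^sub>2 = "shift_arg B\<^sub>2"
      and ?C\<^sub>2 = "shift_arg C\<^sub>2" and ?D\<^sub>2 = "shift_arg D\<^sub>2"
    \<comment> \<open>Multiplicativity of the quantum determinant: grouped by left factors, the
      first and last right factors vanish by the exchange relations and the middle two are the
      determinant of the right matrix.\<close>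
    have "shift_arg A' * D' - shift_arg B' * C' =
        tensor_fls (?A\<^sub>1 * C\<^sub>1) (?A\<^sub>2 * B\<^sub>2 - ?B\<^sub>2 * A\<^sub>2)
        + tensor_fls (?A\<^sub>1 * D\<^sub>1) (?A\<^sub>2 * D\<^sub>2 - ?B\<^sub>2 * C\<^sub>2)
        - tensor_fls (?B\<^sub>1 * C\<^sub>1) (?D\<^sub>2 * A\<^sub>2 - ?C\<^sub>2 * B\<^sub>2)
        + tensor_fls (?B\<^sub>1 * D\<^sub>1) (?C\<^sub>2 * D\<^sub>2 - ?D\<^sub>2 * C\<^sub>2)"
      by (simp add: A'_def B'_def C'_def D'_def shift_arg_add shift_arg_tensor_fls distrib_left
          distrib_right tensor_fls_mult tensor_fls_diff_right)
    also have "\<dots> = tensor_fls (?A\<^sub>1 * D\<^sub>1 - ?B\<^sub>1 * C\<^sub>1) (complex_fls b)"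
      by (simp add: R.A_B R.A_D R.D_A R.C_D tensor_fls_diff_left)
    finally show ?thesis by (simp add: L.A_D tensor_fls_complex_fls)
  qed
  ultimately show ?thesis
    unfolding minor_relations_def A'_def[symmetric] C' B' D' by blast
qed

end

section \<open>Relations and currents of the Yangian\<close>

lemma yangian_relators_in_ideal: "p \<in> yangian_relators \<Longrightarrow> p \<in> ideal_generated yangian_relators"
  using ideal_generated.generator[of p yangian_relators 1 1] by simp

lemma yangian_h_h: "commutator (h r) (h s) = 0"
  unfolding commutator_def
  by transfer (use yangian_relators_in_ideal[OF yangian_relators.hh] in \<open>simp add: commutator_def\<close>)

lemma yangian_h0_xp: "commutator (h 0) (xp s) = xp s + xp s"
  unfolding commutator_def
  by transfer (use yangian_relators_in_ideal[OF yangian_relators.h0_xp] in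
    \<open>simp add: commutator_def mult_2\<close>)

lemma yangian_h0_xm: "commutator (h 0) (xm s) = - (xm s + xm s)"
  unfolding commutator_def
  by transfer (use yangian_relators_in_ideal[OF yangian_relators.h0_xm] in
    \<open>simp add: commutator_def mult_2 algebra_simps\<close>)

lemma yangian_h_xp: "commutator (h (Suc r)) (xp s) - commutator (h r) (xp (Suc s)) =
    h r * xp s + xp s * h r"
  unfolding commutator_def
  by transfer (use yangian_relators_in_ideal[OF yangian_relators.h_xp] in
    \<open>simp add: commutator_def\<close>)

lemma yangian_h_xm: "commutator (h (Suc r)) (xm s) - commutator (h r) (xm (Suc s)) =
    - (h r * xm s + xm s * h r)"
  unfolding commutator_def
  by transfer (use yangian_relators_in_ideal[OF yangian_relators.h_xm] in
    \<open>simp add: commutator_def algebra_simps\<close>)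

lemma yangian_xp_xm: "commutator (xp r) (xm s) = h (r + s)"
  unfolding commutator_def
  by transfer (use yangian_relators_in_ideal[OF yangian_relators.xp_xm] in
    \<open>simp add: commutator_def\<close>)

lemma yangian_xp_xp: "commutator (xp (Suc r)) (xp s) - commutator (xp r) (xp (Suc s)) =
    xp r * xp s + xp s * xp r"
  unfolding commutator_def
  by transfer (use yangian_relators_in_ideal[OF yangian_relators.xp_xp] in
    \<open>simp add: commutator_def\<close>)

lemma yangian_xm_xm: "commutator (xm (Suc r)) (xm s) - commutator (xm r) (xm (Suc s)) =
    - (xm r * xm s + xm s * xm r)"
  unfolding commutator_def
  by transfer (use yangian_relators_in_ideal[OF yangian_relators.xm_xm] in
    \<open>simp add: commutator_def algebra_simps\<close>)

text \<open>The hypothesis for r = i, s = n - i is an increment of \<open>T\<close>. Telescoping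
  gives T (n + 1) - T 0, twice the wanted bracket by antisymmetry. The element \<open>t\<close> is 1
  for x^+ and -1 for x^-.\<close>

lemma commutator_current_zero_mode:
  fixes x :: "nat \<Rightarrow> 'a::complex_algebra_1"
  assumes "\<And>r s. commutator (x (Suc r)) (x s) - commutator (x r) (x (Suc s)) =
    t * (x r * x s + x s * x r)"
  shows "commutator (x (Suc n)) (x 0) = t * (\<Sum>i\<le>n. x i * x (n - i))"
proof (rule add_self_cancel)
  define T where "T i = commutator (x i) (x (Suc n - i))" for i
  let ?Q = "\<Sum>i\<le>n. x i * x (n - i)"
  have "commutator (x (Suc n)) (x 0) + commutator (x (Suc n)) (x 0) = T (Suc n) - T 0"
    by (simp add: T_def commutator_swap[of "x 0"])
  also have "\<dots> = (\<Sum>i\<le>n. T (Suc i) - T i)"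
    by (simp only: lessThan_Suc_atMost[symmetric] sum_lessThan_telescope)
  also have "\<dots> = (\<Sum>i\<le>n. t * (x i * x (n - i) + x (n - i) * x i))"
    by (intro sum.cong) (simp_all add: T_def Suc_diff_le flip: assms)
  also have "\<dots> = t * (?Q + (\<Sum>i\<le>n. x (n - i) * x i))"
    by (simp add: distrib_left sum.distrib sum_distrib_left)
  also have "(\<Sum>i\<le>n. x (n - i) * x i) = ?Q"
    by (rule sum.reindex_bij_witness[of _ "\<lambda>i. n - i" "\<lambda>i. n - i"]) auto
  finally show "commutator (x (Suc n)) (x 0) + commutator (x (Suc n)) (x 0) = t * ?Q + t * ?Q"
    by (simp add: distrib_left)
qed

lemma commutator_xp1_xp0: "commutator (xp 1) (xp 0) = xp 0 * xp 0"
  using commutator_current_zero_mode[of xp 1 0] yangian_xp_xp by simp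

interpretation yangian: current_generators "xp 0" "xm 0" "xp 1"
  by standard (simp_all only: yangian_xp_xm add_0 yangian_h0_xp yangian_h0_xm commutator_xp1_xp0)

text \<open>The current \<open>\<Sum>n. x\<^sub>n\<^sub>+\<^sub>s z\<^sup>-\<^sup>n\<^sup>-\<^sup>1\<close>.\<close>

definition current :: "(nat \<Rightarrow> 'a::zero) \<Rightarrow> nat \<Rightarrow> 'a fls" where
  "current x s = fls_shift (-1) (fps_to_fls (Abs_fps (\<lambda>n. x (n + s))))"

lemma current_nth: "current x s $$ k = (if k < 1 then 0 else x (nat (k - 1) + s))"
  by (simp add: current_def)

lemma vanishes_below_current: "vanishes_below 1 (current x s)"
  by (simp add: vanishes_below_def current_nth)

lemma X_inv_current: "fls_X_inv * current x s = fls_const (x s) + current x (Suc s)"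
  for x :: "nat \<Rightarrow> 'a::ring_1"
proof (rule fls_eqI)
  fix k :: int
  have "nat k + s = nat (k - 1) + Suc s" if "k \<ge> 1" using that by linarith
  then show "(fls_X_inv * current x s) $$ k = (fls_const (x s) + current x (Suc s)) $$ k"
    by (simp add: fls_X_inv_mult_nth current_nth)
qed

lemma commutator_current_square:
  fixes x :: "nat \<Rightarrow> 'a::complex_algebra_1"
  assumes "\<And>r s. commutator (x (Suc r)) (x s) - commutator (x r) (x (Suc s)) =
    t * (x r * x s + x s * x r)"
  shows "commutator (current x 0) (fls_const (x 0)) = fls_const t * (current x 0 * current x 0)"
proof (rule fls_eqI_from)
  note v = vanishes_below_current[of x 0]
  show "vanishes_below (1 + 1) (fls_const t * (current x 0 * current x 0))"
    using fls_times_from(1)[OF v v] by (simp add: vanishes_below_def)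
  show "vanishes_below (1 + 1) (commutator (current x 0) (fls_const (x 0)))"
    unfolding vanishes_below_def commutator_fls_const_nth
  proof (intro allI impI)
    fix k :: int assume "k < 1 + 1"
    then consider "k < 1" | "k = 1" by linarith
    then show "commutator (current x 0 $$ k) (x 0) = 0" by cases (auto simp: current_nth)
  qed
  show "commutator (current x 0) (fls_const (x 0)) $$ (1 + 1 + int n) =
      (fls_const t * (current x 0 * current x 0)) $$ (1 + 1 + int n)" for n
    unfolding commutator_fls_const_nth fls_mult_const_nth fls_times_from(2)[OF v v]
    using commutator_current_zero_mode[of x t n, OF assms]
    by (simp add: current_nth nat_add_distrib del: of_nat_diff)
qed

text \<open>Multiplication by z lowers indices by one, so coefficient k of \<open>U s\<close> is
  coefficient k - j of \<open>U (s + j)\<close>, which lies below the common bound for large j. This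
  turns recursions in the mode number into closed formulas with currents.\<close>

lemma bounded_shift_family_eq_zero:
  fixes U :: "nat \<Rightarrow> 'a::ring_1 fls"
  assumes "\<And>s. vanishes_below d (U s)" and "\<And>s. fls_X_inv * U s = U (Suc s)"
  shows "U s = 0"
proof (rule fls_eqI)
  fix k
  have "U s $$ k = U (s + j) $$ (k - int j)" for j
  proof (induction j)
    case (Suc j)
    have "U (s + j) $$ (k - int j) = (fls_X_inv * U (s + j)) $$ (k - int (Suc j))"
      by (simp add: fls_X_inv_mult_nth)
    then show ?case using Suc assms(2) by simp
  qed simp
  from this[of "nat (k - d + 1)"] show "U s $$ k = 0 $$ k"
    using assms(1) by (simp add: vanishes_below_def)
qed

section \<open>The series h(z) and its relations with x^+ and x^-\<close>

lemma int_cases_pos: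
  fixes k :: int
  obtains "k < 0" | "k = 0" | n where "k = int (Suc n)"
proof (cases "k > 0")
  case True
  then have "k = int (Suc (nat (k - 1)))" by simp
  then show thesis using that(3) by blast
qed (use that(1,2) in linarith)

lemma h_series_nth: "h_series $$ k = (if k < 0 then 0 else if k = 0 then 1 else h (nat (k - 1)))"
  by (cases k rule: int_cases_pos) (auto simp: h_series_def nat_add_distrib)

lemma vanishes_below_h_series: "vanishes_below 0 h_series" "h_series $$ 0 = 1"
  by (simp_all add: vanishes_below_def h_series_nth)

lemma h_series_current_relation:
  assumes "\<And>s. commutator (h 0) (x s) = t * (x s + x s)"
    and "\<And>r s. commutator (h (Suc r)) (x s) - commutator (h r) (x (Suc s)) =
      t * (h r * x s + x s * h r)"
  shows "fls_X_inv * commutator h_series (fls_const (x s)) - commutator h_series (fls_const (x (Suc s)))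
    = fls_const t * (h_series * fls_const (x s) + fls_const (x s) * h_series)"
proof (rule fls_eqI)
  fix k :: int
  have "(fls_X_inv * commutator h_series (fls_const (x s))) $$ k -
        commutator h_series (fls_const (x (Suc s))) $$ k =
      t * (h_series $$ k * x s + x s * h_series $$ k)"
  \<comment> \<open>Index -1 sees only the central coefficient 1 of \<open>h_series\<close>, index 0
    is the relation for h_0, and index n + 1 is the general relation with r = n.\<close>
  proof (cases k rule: int_cases_pos)
    case 1
    then show ?thesis
      by (cases "k = -1") (simp_all add: fls_X_inv_mult_nth commutator_fls_const_nth h_series_nth
          commutator_def)
  next
    case 2
    then show ?thesis using assms(1)[of s]
      by (simp add: fls_X_inv_mult_nth commutator_fls_const_nth h_series_nth commutator_def[of 1])
  next
    case (3 n)
    then show ?thesis using assms(2)[of n s]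
      by (simp add: fls_X_inv_mult_nth commutator_fls_const_nth h_series_nth nat_add_distrib)
  qed
  then show "(fls_X_inv * commutator h_series (fls_const (x s)) -
        commutator h_series (fls_const (x (Suc s)))) $$ k =
      (fls_const t * (h_series * fls_const (x s) + fls_const (x s) * h_series)) $$ k"
    by simp
qed

section \<open>Commutativity of the Cartan subalgebra\<close>

lemma subalgebra_commute:
  assumes "x \<in> subalgebra_generated S" and "\<And>s. s \<in> S \<Longrightarrow> s * y = y * s"
  shows "x * y = y * x"
  using assms(1)
proof induction
  case (mult x x')
  then show ?case by (metis mult.assoc)
qed (simp_all add: assms(2) mult_scaleC_left mult_scaleC_right distrib_left distrib_right)

lemma h_commute: "h r * h s = h s * h r"
  using yangian_h_h[of r s] by (simp add: commutator_def)

lemma yangian_Cartan_commute: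
  assumes "x \<in> yangian_Cartan" "y \<in> yangian_Cartan"
  shows "x * y = y * x"
proof -
  have "y * h r = h r * y" for r
    using assms(2) unfolding yangian_Cartan_def
    by (rule subalgebra_commute) (auto simp: h_commute)
  then show ?thesis
    using assms(1) unfolding yangian_Cartan_def by (intro subalgebra_commute[of x]) auto
qed

section \<open>The series with coefficients in the Cartan subalgebra\<close>

definition coeffs_in :: "'a set \<Rightarrow> 'a::zero fls \<Rightarrow> bool" where
  "coeffs_in V f \<longleftrightarrow> (\<forall>k. f $$ k \<in> V)"

lemma subalgebra_zero: "0 \<in> subalgebra_generated S"
  using subalgebra_generated.scale[OF subalgebra_generated.one, where c = 0] by simp

lemma subalgebra_sum:
  "(\<And>i. i \<in> I \<Longrightarrow> f i \<in> subalgebra_generated S) \<Longrightarrow> sum f I \<in> subalgebra_generated S"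
  by (induction I rule: infinite_finite_induct) (auto intro: subalgebra_zero subalgebra_generated.add)

lemma coeffs_in_mult:
  assumes "coeffs_in (subalgebra_generated S) f" "coeffs_in (subalgebra_generated S) g"
  shows "coeffs_in (subalgebra_generated S) (f * g)"
  unfolding coeffs_in_def
proof
  fix k
  show "(f * g) $$ k \<in> subalgebra_generated S"
    unfolding fls_times_nth(2)[of f g k]
    by (intro subalgebra_sum subalgebra_generated.mult) (use assms in \<open>simp_all add: coeffs_in_def\<close>)
qed

lemma coeffs_in_shift_arg:
  assumes "coeffs_in (subalgebra_generated S) f"
  shows "coeffs_in (subalgebra_generated S) (shift_arg f)"
  unfolding coeffs_in_def
proof
  fix k
  have v: "vanishes_below (fls_subdegree f) f" by (rule vanishes_below_fls_subdegree)
  show "shift_arg f $$ k \<in> subalgebra_generated S"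
  proof (cases "k < fls_subdegree f")
    case True
    then show ?thesis
      using shift_arg_from(1)[OF v] subalgebra_zero by (simp add: vanishes_below_def)
  next
    case False
    then obtain n where k: "k = fls_subdegree f + int n" by (metis zle_iff_zadd linorder_not_less)
    show ?thesis
      unfolding k shift_arg_from(2)[OF v]
      by (intro subalgebra_sum subalgebra_generated.scale) (use assms in \<open>simp add: coeffs_in_def\<close>)
  qed
qed

lemma coeffs_in_add:
  "coeffs_in (subalgebra_generated S) f \<Longrightarrow> coeffs_in (subalgebra_generated S) g \<Longrightarrow>
    coeffs_in (subalgebra_generated S) (f + g)"
  by (auto simp: coeffs_in_def intro: subalgebra_generated.add)

lemma coeffs_in_diff:
  assumes "coeffs_in (subalgebra_generated S) f" "coeffs_in (subalgebra_generated S) g"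
  shows "coeffs_in (subalgebra_generated S) (f - g)"
  unfolding coeffs_in_def
proof
  fix k
  have "f $$ k + (-1) *\<^sub>C (g $$ k) \<in> subalgebra_generated S"
    using assms by (intro subalgebra_generated.add subalgebra_generated.scale) (auto simp: coeffs_in_def)
  then show "(f - g) $$ k \<in> subalgebra_generated S" by (simp add: scaleC_minus_one)
qed

lemma coeffs_in_complex_fls: "coeffs_in (subalgebra_generated S) (complex_fls a)"
  by (auto simp: coeffs_in_def complex_fls_nth intro: subalgebra_generated.intros)

lemma coeffs_in_shifted_const:
  "x \<in> subalgebra_generated S \<Longrightarrow> coeffs_in (subalgebra_generated S) (fls_shift d (fls_const x))"
  by (auto simp: coeffs_in_def intro: subalgebra_zero)

lemma coeffs_in_h_series: "coeffs_in yangian_Cartan h_series"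
  by (auto simp: coeffs_in_def yangian_Cartan_def h_series_nth
      intro: subalgebra_zero subalgebra_generated.intros)

lemma Cartan_series_commute:
  "coeffs_in yangian_Cartan f \<Longrightarrow> coeffs_in yangian_Cartan g \<Longrightarrow> f * g = g * f"
  by (rule fls_times_commute_coeffs) (simp add: coeffs_in_def yangian_Cartan_commute)

text \<open>The lowest coefficient of either sum is twice that of \<open>P\<close>.\<close>

lemma leading_pair_eq_zero:
  assumes "vanishes_below d U" "U $$ d = 1" "vanishes_below d V" "V $$ d = 1"
    and "U * shift_arg P + P * V = 0 \<or> U * P + shift_arg P * V = 0"
  shows "P = 0"
proof (rule ccontr)
  assume "P \<noteq> 0"
  define k where "k = fls_subdegree P"
  have v: "vanishes_below k P" and vS: "vanishes_below k (shift_arg P)"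
    by (simp_all add: k_def vanishes_below_fls_subdegree shift_arg_from)
  note low = fls_times_lowest[OF assms(1) vS] fls_times_lowest[OF v assms(3)]
    fls_times_lowest[OF assms(1) v] fls_times_lowest[OF vS assms(3)]
  have "P $$ k + P $$ k = 0"
    using assms(5)
  proof
    assume "U * shift_arg P + P * V = 0"
    then have "(U * shift_arg P + P * V) $$ (d + k) = 0" by simp
    then show ?thesis using low assms(2,4) shift_arg_lowest[OF v] by (simp add: add.commute)
  next
    assume "U * P + shift_arg P * V = 0"
    then have "(U * P + shift_arg P * V) $$ (d + k) = 0" by simp
    then show ?thesis using low assms(2,4) shift_arg_lowest[OF v] by (simp add: add.commute)
  qed
  moreover have "P $$ k \<noteq> 0"
    unfolding k_def by (rule nth_fls_subdegree_nonzero) fact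
  ultimately show False by (simp add: add_self_eq_0_iff)
qed

section \<open>Existence and uniqueness of the series A\<close>

definition Cartan_factor :: "complex fls \<Rightarrow> int \<Rightarrow> yangian fls \<Rightarrow> bool" where
  "Cartan_factor a m A \<longleftrightarrow> has_leading_term A m \<and> coeffs_in yangian_Cartan A \<and>
     A * shift_arg A * h_series = complex_fls a"

text \<open>The difference of the two products A(z) A(z-1) begins with twice the lowest coefficient
  of A - A'. Multiplication by h(z), whose leading coefficient is 1, preserves that coefficient and
  yields 0.\<close>

lemma Cartan_factor_unique:
  assumes "Cartan_factor a m A" "Cartan_factor a m A'"
  shows "A = A'"
proof (rule ccontr)
  assume "A \<noteq> A'"
  define \<delta> k where "\<delta> = A - A'" and "k = fls_subdegree \<delta>"
  have A: "vanishes_below (-m) A" "A $$ (-m) = 1" "vanishes_below (-m) A'" "A' $$ (-m) = 1"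
    using assms by (simp_all add: Cartan_factor_def has_leading_term_altdef)
  have v: "vanishes_below k \<delta>" by (simp add: k_def vanishes_below_fls_subdegree)
  let ?Q = "A * shift_arg \<delta> + \<delta> * shift_arg A'"
  have vQ: "vanishes_below (-m + k) ?Q" "?Q $$ (-m + k) = \<delta> $$ k + \<delta> $$ k"
    using fls_times_from(1)[OF A(1) shift_arg_from(1)[OF v]]
      fls_times_from(1)[OF v shift_arg_from(1)[OF A(3)]]
      fls_times_lowest[OF A(1) shift_arg_from(1)[OF v]]
      fls_times_lowest[OF v shift_arg_from(1)[OF A(3)]]
      shift_arg_lowest[OF v] shift_arg_lowest[OF A(3)] A(2,4)
    by (simp_all add: vanishes_below_add add.commute)
  have "?Q * h_series = A * shift_arg A * h_series - A' * shift_arg A' * h_series"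
    by (simp add: \<delta>_def shift_arg_diff algebra_simps)
  also have "\<dots> = 0" using assms by (simp add: Cartan_factor_def)
  finally have "\<delta> $$ k + \<delta> $$ k = 0"
    using fls_times_lowest[OF vQ(1) vanishes_below_h_series(1)] vanishes_below_h_series(2) vQ(2) by simp
  moreover have "\<delta> $$ k \<noteq> 0"
    unfolding k_def by (rule nth_fls_subdegree_nonzero) (use \<open>A \<noteq> A'\<close> in \<open>simp add: \<delta>_def\<close>)
  ultimately show False by (simp add: add_self_eq_0_iff)
qed

text \<open>
  Adding \<open>r z\<^sup>i / 2\<close> to \<open>A\<close> adds \<open>r\<close> to the coefficient of \<open>A(z) A(z - 1) h(z)\<close> at \<open>z\<^sup>m\<^sup>+\<^sup>i\<close> and changes
  no coefficient at a higher power.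
\<close>

primrec factor_approx :: "complex fls \<Rightarrow> int \<Rightarrow> nat \<Rightarrow> yangian fls" where
  "factor_approx a m 0 = fls_shift m 1"
| "factor_approx a m (Suc k) = (let T = factor_approx a m k in
     T + fls_shift (m - int (Suc k)) (fls_const
       ((1/2) *\<^sub>C ((complex_fls a - T * shift_arg T * h_series) $$ (- 2 * m + int (Suc k))))))"

lemma factor_approx_properties:
  assumes "has_leading_term a (2 * m)"
  shows "vanishes_below (-m) (factor_approx a m k) \<and> factor_approx a m k $$ (-m) = 1 \<and>
    coeffs_in yangian_Cartan (factor_approx a m k) \<and>
    vanishes_below (- 2 * m + int (Suc k))
      (complex_fls a - factor_approx a m k * shift_arg (factor_approx a m k) * h_series)"
proof (induction k)
  case 0
  let ?T = "fls_shift m 1 :: yangian fls"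
  have T: "vanishes_below (-m) ?T" "?T $$ (-m) = 1" by (simp_all add: vanishes_below_def)
  have a: "vanishes_below (- 2 * m) (complex_fls a :: yangian fls)"
    "(complex_fls a :: yangian fls) $$ (- 2 * m) = 1"
    using assms vanishes_below_complex_fls
    by (auto simp: has_leading_term_altdef complex_fls_nth scaleC_one)
  note vS = shift_arg_from(1)[OF T(1)]
  note v1 = fls_times_from(1)[OF T(1) vS]
  have p: "vanishes_below (- 2 * m) (?T * shift_arg ?T * h_series)"
    "(?T * shift_arg ?T * h_series) $$ (- 2 * m) = 1"
    using fls_times_from(1)[OF v1 vanishes_below_h_series(1)]
      fls_times_lowest[OF v1 vanishes_below_h_series(1)] fls_times_lowest[OF T(1) vS]
      shift_arg_lowest[OF T(1)] T(2) vanishes_below_h_series(2)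
    by simp_all
  have "vanishes_below (- 2 * m + 1) (complex_fls a - ?T * shift_arg ?T * h_series)"
    unfolding vanishes_below_def
  proof (intro allI impI)
    fix j assume "j < - 2 * m + 1"
    then consider "j < - 2 * m" | "j = - 2 * m" by linarith
    then show "(complex_fls a - ?T * shift_arg ?T * h_series) $$ j = 0"
    proof cases
      case 1
      with a(1) p(1) show ?thesis by (simp add: vanishes_below_def)
    next
      case 2
      with a(2) p(2) show ?thesis by simp
    qed
  qed
  moreover have "coeffs_in yangian_Cartan ?T"
    by (auto simp: coeffs_in_def yangian_Cartan_def intro: subalgebra_zero subalgebra_generated.one)
  ultimately show ?case using T by simp
next
  case (Suc k)
  define T where "T = factor_approx a m k"
  define R where "R = complex_fls a - T * shift_arg T * h_series"
  define r where "r = R $$ (- 2 * m + int (Suc k))"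
  define \<rho> where "\<rho> = fls_shift (m - int (Suc k)) (fls_const ((1/2) *\<^sub>C r))"
  have T': "factor_approx a m (Suc k) = T + \<rho>"
    by (simp add: T_def R_def r_def \<rho>_def Let_def)
  have T: "vanishes_below (-m) T" "T $$ (-m) = 1" "coeffs_in yangian_Cartan T"
    and R: "vanishes_below (- 2 * m + int (Suc k)) R"
    using Suc by (simp_all add: T_def R_def)
  have \<rho>: "vanishes_below (-m + int (Suc k)) \<rho>" "\<rho> $$ (-m + int (Suc k)) = (1/2) *\<^sub>C r"
    by (auto simp: \<rho>_def vanishes_below_def)
  have \<rho>': "vanishes_below (-m) \<rho>" "\<rho> $$ (-m) = 0"
    using \<rho>(1) by (auto simp: vanishes_below_def)
  have vT': "vanishes_below (-m) (T + \<rho>)" "(T + \<rho>) $$ (-m) = 1"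
    using T \<rho>' by (simp_all add: vanishes_below_add)
  have "coeffs_in yangian_Cartan R"
    using T(3) coeffs_in_h_series unfolding R_def yangian_Cartan_def
    by (intro coeffs_in_diff coeffs_in_mult coeffs_in_shift_arg coeffs_in_complex_fls)
  then have "coeffs_in yangian_Cartan \<rho>"
    unfolding \<rho>_def r_def yangian_Cartan_def
    by (intro coeffs_in_shifted_const subalgebra_generated.scale) (simp add: coeffs_in_def)
  then have C: "coeffs_in yangian_Cartan (T + \<rho>)"
    using T(3) unfolding yangian_Cartan_def by (intro coeffs_in_add)
  \<comment> \<open>The change of T(z) T(z-1) when \<rho> is added to T; each summand contributes
    half of \<open>r\<close> at the lowest index.\<close>
  let ?Q = "T * shift_arg \<rho> + \<rho> * shift_arg (T + \<rho>)"
  note v = fls_times_from(1)[OF T(1) shift_arg_from(1)[OF \<rho>(1)]]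
    fls_times_from(1)[OF \<rho>(1) shift_arg_from(1)[OF vT'(1)]]
  note low = fls_times_lowest[OF T(1) shift_arg_from(1)[OF \<rho>(1)]]
    fls_times_lowest[OF \<rho>(1) shift_arg_from(1)[OF vT'(1)]]
  have half: "(1/2) *\<^sub>C r + (1/2) *\<^sub>C r = r"
    by (simp add: scaleC_one flip: scaleC_add_left)
  have "vanishes_below (- 2 * m + int (Suc k)) ?Q"
    using v by (intro vanishes_below_add) (simp_all add: algebra_simps)
  moreover have "?Q $$ (- 2 * m + int (Suc k)) = r"
    using low shift_arg_lowest[OF \<rho>(1)] shift_arg_lowest[OF vT'(1)] T(2) vT'(2) \<rho>(2) half
    by (simp add: algebra_simps)
  ultimately have Q: "vanishes_below (- 2 * m + int (Suc k)) (?Q * h_series)"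
    "(?Q * h_series) $$ (- 2 * m + int (Suc k)) = r"
    using fls_times_from(1)[of _ ?Q, OF _ vanishes_below_h_series(1)]
      fls_times_lowest[of _ ?Q, OF _ vanishes_below_h_series(1)] vanishes_below_h_series(2)
    by fastforce+
  have eq: "complex_fls a - (T + \<rho>) * shift_arg (T + \<rho>) * h_series = R - ?Q * h_series"
    by (simp add: R_def shift_arg_add algebra_simps)
  have "vanishes_below (- 2 * m + int (Suc (Suc k))) (R - ?Q * h_series)"
    unfolding vanishes_below_def
  proof (intro allI impI)
    fix j assume "j < - 2 * m + int (Suc (Suc k))"
    then consider "j < - 2 * m + int (Suc k)" | "j = - 2 * m + int (Suc k)" by linarith
    then show "(R - ?Q * h_series) $$ j = 0"
    proof cases
      case 1
      with R Q(1) show ?thesis by (simp add: vanishes_below_def)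
    next
      case 2
      with Q(2) show ?thesis by (simp add: r_def)
    qed
  qed
  with vT' C show ?case unfolding T' eq by blast
qed

lemma Cartan_factor_exists:
  assumes "has_leading_term a (2 * m)"
  shows "\<exists>A. Cartan_factor a m A"
proof -
  note props = factor_approx_properties[OF assms]
  let ?T = "factor_approx a m"
  \<comment> \<open>Stage k fixes the coefficients up to index -m + k, so index j is final from
    stage j + m on. Below -m, \<open>nat\<close> selects stage 0, whose coefficient there is
    0.\<close>
  define A where "A = Abs_fls (\<lambda>j. ?T (nat (j + m)) $$ j)"
  have A_nth: "A $$ j = ?T (nat (j + m)) $$ j" for j
    unfolding A_def
    by (rule nth_Abs_fls_lower_bound[of "-m"]) (use props in \<open>simp add: vanishes_below_def\<close>)
  have stable: "?T (k + l) $$ j = ?T k $$ j" if "j < -m + int (Suc k)" for j k l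
    using that by (induction l) (simp_all add: Let_def)
  have diff: "vanishes_below (-m + int (Suc k)) (A - ?T k)" for k
    unfolding vanishes_below_def
  proof (intro allI impI)
    fix j assume j: "j < -m + int (Suc k)"
    show "(A - ?T k) $$ j = 0"
    proof (cases "j < -m")
      case True
      then show ?thesis using props by (simp add: A_nth vanishes_below_def)
    next
      case False
      then have "j < -m + int (Suc (nat (j + m)))" "nat (j + m) \<le> k" using j by linarith+
      then show ?thesis using stable[of j "nat (j + m)" "k - nat (j + m)"] by (simp add: A_nth)
    qed
  qed
  have A: "vanishes_below (-m) A" "A $$ (-m) = 1"
    using props by (simp_all add: vanishes_below_def A_nth)
  have C: "coeffs_in yangian_Cartan A" using props by (simp add: coeffs_in_def A_nth)
  have "A * shift_arg A * h_series = complex_fls a"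
  proof (rule fls_eqI)
    fix j
    \<comment> \<open>From this stage on, both the defect of the approximation and the effect of
      replacing it by \<open>A\<close> start beyond index j.\<close>
    define k where "k = nat (j + 2 * m)"
    have vT: "vanishes_below (-m) (?T k)" using props by blast
    let ?Q = "A * shift_arg (A - ?T k) + (A - ?T k) * shift_arg (?T k)"
    have "vanishes_below (- 2 * m + int (Suc k)) ?Q"
      using fls_times_from(1)[OF A(1) shift_arg_from(1)[OF diff[of k]]]
        fls_times_from(1)[OF diff[of k] shift_arg_from(1)[OF vT]]
      by (intro vanishes_below_add) (simp_all add: algebra_simps)
    from fls_times_from(1)[OF this vanishes_below_h_series(1)]
    have "(?Q * h_series) $$ j = 0" by (simp add: vanishes_below_def k_def)
    moreover have "(complex_fls a - ?T k * shift_arg (?T k) * h_series) $$ j = 0"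
      using props[of k] by (simp add: vanishes_below_def k_def)
    moreover have "A * shift_arg A * h_series - complex_fls a =
        ?Q * h_series - (complex_fls a - ?T k * shift_arg (?T k) * h_series)"
      by (simp add: shift_arg_diff algebra_simps)
    ultimately have "(A * shift_arg A * h_series - complex_fls a) $$ j = 0" by simp
    then show "(A * shift_arg A * h_series) $$ j = complex_fls a $$ j" by simp
  qed
  with A C show ?thesis by (auto simp: Cartan_factor_def has_leading_term_altdef)
qed

text \<open>A(z) A(z-1) has leading coefficient 1, so its right inverse is genuine. It commutes with
  h(z), and a(z) is central, so the fraction can be multiplied out.\<close>

lemma Cartan_factor_iff:
  "Cartan_factor a m A \<longleftrightarrow> has_leading_term A m \<and> (\<forall>k. A $$ k \<in> yangian_Cartan) \<and>
     h_series = complex_fls a * fls_right_inverse (A * shift_arg A) 1"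
proof -
  let ?N = "A * shift_arg A"
  have "?N * h_series = complex_fls a \<longleftrightarrow> h_series = complex_fls a * fls_right_inverse ?N 1"
    if lead: "has_leading_term A m" and C: "coeffs_in yangian_Cartan A"
  proof -
    have A: "vanishes_below (-m) A" "A $$ (-m) = 1"
      using lead by (simp_all add: has_leading_term_altdef)
    have "has_leading_term ?N (2 * m)"
      using fls_times_from(1)[OF A(1) shift_arg_from(1)[OF A(1)]]
        fls_times_lowest[OF A(1) shift_arg_from(1)[OF A(1)]] shift_arg_lowest[OF A(1)] A(2)
      by (simp add: has_leading_term_altdef)
    then have inv: "?N * fls_right_inverse ?N 1 = 1"
      by (intro fls_right_inverse) (simp add: has_leading_term_def)
    have Nh: "?N * h_series = h_series * ?N"
      using C coeffs_in_h_series
      by (intro Cartan_series_commute) (simp_all add: yangian_Cartan_def coeffs_in_mult coeffs_in_shift_arg)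
    show ?thesis
    proof
      assume "?N * h_series = complex_fls a"
      then have "complex_fls a * fls_right_inverse ?N 1 = h_series * (?N * fls_right_inverse ?N 1)"
        by (metis Nh mult.assoc)
      then show "h_series = complex_fls a * fls_right_inverse ?N 1"
        by (simp only: inv mult_1_right)
    next
      assume "h_series = complex_fls a * fls_right_inverse ?N 1"
      then have "?N * h_series = complex_fls a * (?N * fls_right_inverse ?N 1)"
        by (metis mult.assoc complex_fls_central)
      then show "?N * h_series = complex_fls a" by (simp only: inv mult_1_right)
    qed
  qed
  then show ?thesis by (auto simp: Cartan_factor_def coeffs_in_def)
qed

lemma Cartan_factor_A_series:
  assumes "has_leading_term a (2 * m)"
  shows "Cartan_factor a m (A_series m a)"
  unfolding A_series_def Cartan_factor_iff[symmetric]
  using Cartan_factor_exists[OF assms] Cartan_factor_unique by (blast intro: theI)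

section \<open>Commutation of A with the modes and currents of x^+ and x^-\<close>

lemma Cartan_factor_intertwine:
  assumes A: "Cartan_factor a m A" and a: "has_leading_term a (2 * m)"
    and rel: "h_series * v = u * h_series"
  shows "(shift_arg A * A) * u = v * (shift_arg A * A)"
proof -
  let ?N = "A * shift_arg A"
  let ?a = "complex_fls a :: yangian fls"
  have C: "coeffs_in yangian_Cartan A" and Nh: "?N * h_series = ?a"
    using A by (simp_all add: Cartan_factor_def)
  have SA: "shift_arg A * A = ?N"
    using C by (intro Cartan_series_commute) (simp_all add: yangian_Cartan_def coeffs_in_shift_arg)
  have hN: "h_series * ?N = ?a"
    unfolding Nh[symmetric] using C coeffs_in_h_series
    by (intro Cartan_series_commute) (simp_all add: yangian_Cartan_def coeffs_in_mult coeffs_in_shift_arg)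
  have "a \<noteq> 0" using a by (auto simp: has_leading_term_def)
  then have inv: "complex_fls (inverse a) * ?a = 1"
    by (simp add: complex_fls_one flip: complex_fls_mult)
  \<comment> \<open>Multiplying \<open>rel\<close> by N on both sides and using N h = h N = a gives
    a v N = a N u; then a cancels, being a nonzero complex series.\<close>
  have "?a * (v * ?N) = ?N * (h_series * v) * ?N" by (simp add: mult.assoc flip: Nh)
  also have "\<dots> = (?N * u) * (h_series * ?N)" by (simp only: rel mult.assoc)
  also have "\<dots> = ?a * (?N * u)" by (simp add: hN complex_fls_central)
  finally have "complex_fls (inverse a) * ?a * (v * ?N) = complex_fls (inverse a) * ?a * (?N * u)"
    by (simp add: mult.assoc)
  then show ?thesis by (simp add: inv SA)
qed

text \<open>The series u, w, v are successive shifts, and A(z-1) A(z) intertwines u with v. The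
  defect P = A u - w A of a single factor satisfies A(z-1) P(z) + P(z-1) A(z) = 0, which forces P =
  0; this is the claim rearranged.\<close>

lemma Cartan_factor_xp:
  assumes A: "Cartan_factor a m A" and a: "has_leading_term a (2 * m)"
  shows "fls_X_inv * commutator (fls_const (xp s)) A =
    commutator (fls_const (xp (Suc s))) A + A * fls_const (xp s)"
proof -
  let ?x = "fls_const (xp s)" and ?x' = "fls_const (xp (Suc s))"
  define u w v where "u = fls_X_inv * ?x - ?x' + ?x" and "w = fls_X_inv * ?x - ?x'"
    and "v = fls_X_inv * ?x - ?x' - ?x"
  have "h_series * v = u * h_series"
    using h_series_current_relation[of xp 1 s] yangian_h0_xp yangian_h_xp
    by (simp add: u_def v_def commutator_def algebra_simps fls_X_inv_left_commute)
  from Cartan_factor_intertwine[OF A a this]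
  have N: "shift_arg A * A * u = v * (shift_arg A * A)" .
  have S: "shift_arg u = w" "shift_arg w = v"
    by (simp_all add: u_def v_def w_def shift_arg_add shift_arg_diff shift_arg_mult shift_arg_const
        shift_arg_X_inv algebra_simps)
  have lead: "vanishes_below (-m) A" "A $$ (-m) = 1"
    using A by (simp_all add: Cartan_factor_def has_leading_term_altdef)
  have "A * u - w * A = 0"
  proof (rule leading_pair_eq_zero)
    show "vanishes_below (-m) (shift_arg A)" "shift_arg A $$ (-m) = 1"
      using lead by (simp_all add: shift_arg_from shift_arg_lowest)
    have "shift_arg A * (A * u - w * A) + shift_arg (A * u - w * A) * A = 0"
      using N by (simp add: shift_arg_diff shift_arg_mult S algebra_simps)
    then show "shift_arg A * shift_arg (A * u - w * A) + (A * u - w * A) * A = 0 \<or>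
        shift_arg A * (A * u - w * A) + shift_arg (A * u - w * A) * A = 0" ..
  qed (fact lead)+
  then show ?thesis
    by (simp add: u_def w_def commutator_def algebra_simps fls_X_inv_left_commute)
qed

text \<open>With the signs of x^- the successive shifts are v, w, u, so the defect is A w - v A and
  the other alternative of \<open>leading_pair_eq_zero\<close> applies.\<close>

lemma Cartan_factor_xm:
  assumes A: "Cartan_factor a m A" and a: "has_leading_term a (2 * m)"
  shows "fls_X_inv * commutator A (fls_const (xm s)) =
    commutator A (fls_const (xm (Suc s))) + fls_const (xm s) * A"
proof -
  let ?y = "fls_const (xm s)" and ?y' = "fls_const (xm (Suc s))"
  define u w v where "u = fls_X_inv * ?y - ?y' - ?y" and "w = fls_X_inv * ?y - ?y'"
    and "v = fls_X_inv * ?y - ?y' + ?y"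
  have "h_series * v = u * h_series"
    using h_series_current_relation[of xm "-1" s] yangian_h0_xm yangian_h_xm
    by (simp add: u_def v_def commutator_def algebra_simps fls_X_inv_left_commute)
  from Cartan_factor_intertwine[OF A a this]
  have N: "shift_arg A * A * u = v * (shift_arg A * A)" .
  have AS: "shift_arg A * A = A * shift_arg A"
    using A by (intro Cartan_series_commute) (simp_all add: Cartan_factor_def yangian_Cartan_def coeffs_in_shift_arg)
  have S: "shift_arg v = w" "shift_arg w = u"
    by (simp_all add: u_def v_def w_def shift_arg_add shift_arg_diff shift_arg_mult shift_arg_const
        shift_arg_X_inv algebra_simps)
  have lead: "vanishes_below (-m) A" "A $$ (-m) = 1"
    using A by (simp_all add: Cartan_factor_def has_leading_term_altdef)
  have "A * w - v * A = 0"
  proof (rule leading_pair_eq_zero[where U = A and V = "shift_arg A"])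
    show "vanishes_below (-m) (shift_arg A)" "shift_arg A $$ (-m) = 1"
      using lead by (simp_all add: shift_arg_from shift_arg_lowest)
    have "A * shift_arg (A * w - v * A) + (A * w - v * A) * shift_arg A = 0"
      using N unfolding AS by (simp add: shift_arg_diff shift_arg_mult S algebra_simps)
    then show "A * shift_arg (A * w - v * A) + (A * w - v * A) * shift_arg A = 0 \<or>
        A * (A * w - v * A) + shift_arg (A * w - v * A) * shift_arg A = 0" ..
  qed (fact lead)+
  then show ?thesis
    by (simp add: v_def w_def commutator_def algebra_simps fls_X_inv_left_commute)
qed

text \<open>By \<open>Cartan_factor_xp\<close> and \<open>X_inv_current\<close>, multiplying the
  difference of the two sides by z replaces s by s + 1. All these differences start at -m or later,
  so they vanish.\<close>

lemma Cartan_factor_commutator_xp: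
  assumes A: "Cartan_factor a m A" and a: "has_leading_term a (2 * m)"
  shows "commutator (fls_const (xp s)) A = A * current xp s"
proof -
  have lead: "vanishes_below (-m) A"
    using A by (simp add: Cartan_factor_def has_leading_term_altdef)
  have "commutator (fls_const (xp s)) A - A * current xp s = 0"
  proof (rule bounded_shift_family_eq_zero)
    fix s
    have "vanishes_below (-m) (A * current xp s)"
      using fls_times_from(1)[OF lead vanishes_below_current] by (rule vanishes_below_mono) simp
    then show "vanishes_below (-m) (commutator (fls_const (xp s)) A - A * current xp s)"
      by (intro vanishes_below_diff vanishes_below_commutator_const lead)
    show "fls_X_inv * (commutator (fls_const (xp s)) A - A * current xp s) =
        commutator (fls_const (xp (Suc s))) A - A * current xp (Suc s)"
      by (simp add: right_diff_distrib Cartan_factor_xp[OF A a] X_inv_current distrib_left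
          flip: fls_X_inv_left_commute)
  qed
  then show ?thesis by simp
qed

lemma Cartan_factor_commutator_xm:
  assumes A: "Cartan_factor a m A" and a: "has_leading_term a (2 * m)"
  shows "commutator A (fls_const (xm s)) = current xm s * A"
proof -
  have lead: "vanishes_below (-m) A"
    using A by (simp add: Cartan_factor_def has_leading_term_altdef)
  have "commutator A (fls_const (xm s)) - current xm s * A = 0"
  proof (rule bounded_shift_family_eq_zero)
    fix s
    have "vanishes_below (-m) (current xm s * A)"
      using fls_times_from(1)[OF vanishes_below_current lead] by (rule vanishes_below_mono) simp
    then show "vanishes_below (-m) (commutator A (fls_const (xm s)) - current xm s * A)"
      by (intro vanishes_below_diff vanishes_below_commutator_const lead)
    show "fls_X_inv * (commutator A (fls_const (xm s)) - current xm s * A) =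
        commutator A (fls_const (xm (Suc s))) - current xm (Suc s) * A"
      by (simp add: right_diff_distrib Cartan_factor_xm[OF A a] X_inv_current distrib_right
          flip: mult.assoc)
  qed
  then show ?thesis by simp
qed

text \<open>Again a family in s with a common bound. The case s = 0 is the source of the exchange
  relation between A and B.\<close>

lemma Cartan_factor_shift_current:
  assumes A: "Cartan_factor a m A" and a: "has_leading_term a (2 * m)"
  shows "shift_arg A * current xm s = shift_arg (current xm s) * shift_arg A"
proof -
  have lead: "vanishes_below (-m) (shift_arg A)"
    using A by (simp add: Cartan_factor_def has_leading_term_altdef shift_arg_from)
  have "shift_arg A * current xm s - shift_arg (current xm s) * shift_arg A = 0"
  proof (rule bounded_shift_family_eq_zero)
    fix s
    have "vanishes_below (-m) (shift_arg A * current xm s)"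
      using fls_times_from(1)[OF lead vanishes_below_current] by (rule vanishes_below_mono) simp
    moreover have "vanishes_below (-m) (shift_arg (current xm s) * shift_arg A)"
      using fls_times_from(1)[OF shift_arg_from(1)[OF vanishes_below_current] lead]
      by (rule vanishes_below_mono) simp
    ultimately show "vanishes_below (-m)
        (shift_arg A * current xm s - shift_arg (current xm s) * shift_arg A)"
      by (rule vanishes_below_diff)
    \<comment> \<open>Shifting turns the factor z into z - 1, which accounts for the extra current
      in \<open>S\<close>.\<close>
    have "shift_arg (fls_X_inv * current xm s) = fls_X_inv * shift_arg (current xm s) - shift_arg (current xm s)"
      by (simp add: shift_arg_mult shift_arg_X_inv left_diff_distrib)
    then have S: "fls_X_inv * shift_arg (current xm s) =
        shift_arg (current xm s) + fls_const (xm s) + shift_arg (current xm (Suc s))"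
      by (simp add: X_inv_current shift_arg_add shift_arg_const algebra_simps)
    have "commutator (shift_arg A) (fls_const (xm s)) = shift_arg (current xm s) * shift_arg A"
      using arg_cong[OF Cartan_factor_commutator_xm[OF A a, of s], of shift_arg]
      by (simp add: shift_arg_commutator shift_arg_const shift_arg_mult)
    then have K: "shift_arg A * fls_const (xm s) =
        fls_const (xm s) * shift_arg A + shift_arg (current xm s) * shift_arg A"
      by (simp add: commutator_def algebra_simps)
    have "fls_X_inv * (shift_arg A * current xm s - shift_arg (current xm s) * shift_arg A) =
        shift_arg A * (fls_X_inv * current xm s) - (fls_X_inv * shift_arg (current xm s)) * shift_arg A"
      by (simp add: right_diff_distrib fls_X_inv_left_commute mult.assoc)
    also have "\<dots> = shift_arg A * current xm (Suc s) - shift_arg (current xm (Suc s)) * shift_arg A"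
      by (simp add: X_inv_current S distrib_left distrib_right K)
    finally show "fls_X_inv * (shift_arg A * current xm s - shift_arg (current xm s) * shift_arg A) =
        shift_arg A * current xm (Suc s) - shift_arg (current xm (Suc s)) * shift_arg A" .
  qed
  then show ?thesis by simp
qed

section \<open>The monodromy matrix in the Yangian\<close>

lemma commutator_current_xp_xm: "commutator (current xp 0) (fls_const (xm 0)) = h_series - 1"
  by (rule fls_eqI) (auto simp: commutator_fls_const_nth current_nth h_series_nth yangian_xp_xm)

lemma Cartan_factor_commute_h:
  assumes "Cartan_factor a m A"
  shows "commutator (fls_const (h k)) A = 0"
proof (rule fls_eqI)
  fix j
  have "h k \<in> yangian_Cartan" by (auto simp: yangian_Cartan_def intro: subalgebra_generated.generator)
  moreover have "A $$ j \<in> yangian_Cartan" using assms by (simp add: Cartan_factor_def coeffs_in_def)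
  ultimately show "commutator (fls_const (h k)) A $$ j = 0 $$ j"
    using yangian_Cartan_commute by (simp add: commutator_fls_const_nth commutator_def)
qed

text \<open>In terms of currents B = x^-(z) A, C = A x^+(z) and D = A h + B x^+(z), as in a Gauss
  decomposition. The remaining properties are read off from these formulas.\<close>

lemma monodromy_Cartan_factor:
  assumes A: "Cartan_factor a m A" and a: "has_leading_term a (2 * m)"
    and B: "B = commutator A (fls_const (xm 0))"
    and C: "C = commutator (fls_const (xp 0)) A"
    and D: "D = A + commutator C (fls_const (xm 0))"
  shows "monodromy (xp 0) (xm 0) (xp 1) a m A B C D"
proof
  show "has_leading_term A m" using A by (simp add: Cartan_factor_def)
  have B': "B = current xm 0 * A"
    using Cartan_factor_commutator_xm[OF A a] by (simp add: B)
  have C': "C = A * current xp 0"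
    using Cartan_factor_commutator_xp[OF A a] by (simp add: C)
  show "fls_X_inv * C = commutator (fls_const (xp 1)) A + A * fls_const (xp 0)"
    using Cartan_factor_xp[OF A a, of 0] by (simp add: C)
  show "commutator (commutator (fls_const (xp 0)) (fls_const (xm 0))) A = 0"
    "commutator (commutator (fls_const (xp 1)) (fls_const (xm 0))) A = 0"
    using Cartan_factor_commute_h[OF A]
    by (simp_all add: yangian_xp_xm flip: fls_const_commutator)
  have "commutator (fls_const (xp 0)) (current xp 0) = - (current xp 0 * current xp 0)"
    using commutator_current_square[of xp 1] yangian_xp_xp
    by (simp add: commutator_swap[of "fls_const (xp 0)"])
  then show "commutator (fls_const (xp 0)) C = 0"
    by (simp add: C' commutator_mult_right flip: C) (simp add: C' mult.assoc)
  have "commutator (current xm 0) (fls_const (xm 0)) = - (current xm 0 * current xm 0)"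
    using commutator_current_square[of xm "-1"] yangian_xm_xm by simp
  then show "commutator B (fls_const (xm 0)) = 0"
    by (simp add: B' commutator_mult_left flip: B) (simp add: B' mult.assoc)
  show AB: "shift_arg A * B = shift_arg B * A"
    by (simp add: B' shift_arg_mult Cartan_factor_shift_current[OF A a] flip: mult.assoc)
  have SA: "shift_arg A * A = A * shift_arg A"
    using A by (intro Cartan_series_commute) (simp_all add: Cartan_factor_def yangian_Cartan_def coeffs_in_shift_arg)
  have "D = A * h_series + B * current xp 0"
    by (simp add: D C' commutator_mult_left commutator_current_xp_xm right_diff_distrib flip: B)
  \<comment> \<open>The exchange relation turns A(z-1) B x^+(z) into B(z-1) C; what is left is A(z)
    A(z-1) h(z), the scalar series a.\<close>
  then have "shift_arg A * D = A * shift_arg A * h_series + shift_arg B * C"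
    by (simp add: distrib_left SA AB C' flip: mult.assoc)
  then show "shift_arg A * D - shift_arg B * C = complex_fls a"
    using A by (simp add: Cartan_factor_def)
qed (fact B C D)+

theorem theorem8:
  fixes m n :: int and a b :: "complex fls"
    and \<Delta> :: "yangian \<Rightarrow> (yangian, yangian) tensor_product"
  assumes "has_leading_term a (2 * m)"
    and "has_leading_term b (2 * n)"
    and "is_yangian_coproduct \<Delta>"
  shows "map_fls \<Delta> (A_series (m + n) (a * b)) =
    tensor_fls (A_series m a) (A_series n b)
    + tensor_fls (commutator (A_series m a) (fls_const (xm 0)))
                 (commutator (fls_const (xp 0)) (A_series n b))"
proof (rule minor_relations_unique)
  \<comment> \<open>In the coproduct of x^+_1, h_0 is written as the bracket of x^+_0 and x^-_0 to
    match \<open>minor_relations_tensor\<close>.\<close>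
  have hom: "algebra_hom \<Delta>"
    and \<Delta>: "\<Delta> (xp 0) = xp 0 \<otimes> 1 + 1 \<otimes> xp 0" "\<Delta> (xm 0) = xm 0 \<otimes> 1 + 1 \<otimes> xm 0"
      "\<Delta> (xp 1) = xp 1 \<otimes> 1 + 1 \<otimes> xp 1 + commutator (xp 0) (xm 0) \<otimes> xp 0"
    using assms(3) by (simp_all add: is_yangian_coproduct_def yangian_xp_xm)
  have ab: "has_leading_term (a * b) (2 * (m + n))"
    using assms(1,2) fls_times_from(1)[of "- (2 * m)" a "- (2 * n)" b]
      fls_times_lowest[of "- (2 * m)" a "- (2 * n)" b]
    by (simp add: has_leading_term_altdef algebra_simps)
  note monodromy = monodromy_Cartan_factor[OF Cartan_factor_A_series _ refl refl refl]
  interpret M: monodromy "xp 0" "xm 0" "xp 1" "a * b" "m + n" "A_series (m + n) (a * b)"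
      "commutator (A_series (m + n) (a * b)) (fls_const (xm 0))"
      "commutator (fls_const (xp 0)) (A_series (m + n) (a * b))"
      "A_series (m + n) (a * b) + commutator (commutator (fls_const (xp 0))
        (A_series (m + n) (a * b))) (fls_const (xm 0))"
    by (intro monodromy ab)
  have "minor_relations (xp 0) (xm 0) (xp 1) (complex_fls (a * b)) (m + n) (A_series (m + n) (a * b))"
    unfolding minor_relations_def using M.leading M.X_inv_C M.A_D by blast
  from minor_relations_map_fls[OF hom this]
  show "minor_relations (\<Delta> (xp 0)) (\<Delta> (xm 0)) (\<Delta> (xp 1)) (complex_fls (a * b)) (m + n)
      (map_fls \<Delta> (A_series (m + n) (a * b)))" .
  show "minor_relations (\<Delta> (xp 0)) (\<Delta> (xm 0)) (\<Delta> (xp 1)) (complex_fls (a * b)) (m + n)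
     (tensor_fls (A_series m a) (A_series n b)
      + tensor_fls (commutator (A_series m a) (fls_const (xm 0)))
          (commutator (fls_const (xp 0)) (A_series n b)))"
    unfolding \<Delta> by (rule yangian.minor_relations_tensor
        [OF monodromy[OF assms(1) assms(1)] monodromy[OF assms(2) assms(2)]])
qed

end
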